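(* Let $E$ be an order continuous Banach lattice. Then there exist a Hausdorff topological space $X$ and an injective lattice homomorphism $T:E\to S(X)$ whose image $T(E)$ is an (order dense) ideal of $S(X)$, such that $T$ is a homeomorphism from $(E,un)$ onto $T(E)$ equipped with the (subspace topology of the) extended $un$-topology $\tau_E$ on $S(X)$ induced by $T(E)\cong E$.
   Context: For a topological space $X$, $S(X)$ is the Archimedean vector lattice of equivalence classes of continuous real-valued functions defined on open dense subsets of $X$ (identified when they agree on the intersection of domains), with pointwise operations. A Banach lattice is order continuous if $x_\alpha\downarrow0$ implies $\|x_\alpha\|\to0$. In a Banach lattice $E$, a net $(x_\alpha)$ is $un$-convergent to $x$ if $\||x_\alpha-x|\wedge w\|\to0$ for every $w\in E_+$; this defines the $un$-topology. If $Y$ is an Archimedean vector lattice and $I\subseteq Y$ is an ideal which is a normed lattice, the extended $un$-topology on $Y$ induced by $I$ is given by: $y_\alpha\to y$ iff $\||y_\alpha-y|\wedge w\|\to0$ for every $w\in I_+$ (here $T(E)$ carries the norm transported from $E$). *)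

theory Defs
  imports "HOL-Analysis.Analysis"
begin

definition labs :: "'a::{ordered_ab_group_add, lattice} \<Rightarrow> 'a" where
  "labs x = sup x (- x)"

definition banach_lattice :: "'a::{banach, ordered_real_vector, lattice} itself \<Rightarrow> bool" where
  "banach_lattice _ \<longleftrightarrow> (\<forall>x y::'a. labs x \<le> labs y \<longrightarrow> norm x \<le> norm y)"

text \<open>Order continuity: whenever a net decreases to 0, its norms tend to 0.  A decreasing
  net is represented by a downward directed set D (indexed by itself, ordered by the reverse
  order); x_alpha decreases to 0 means D has infimum 0.\<close>

definition order_continuous :: "'a::{banach, ordered_real_vector, lattice} itself \<Rightarrow> bool" where
  "order_continuous _ \<longleftrightarrow>
     (\<forall>D::'a set. D \<noteq> {} \<and> (\<forall>x\<in>D. \<forall>y\<in>D. \<exists>z\<in>D. z \<le> x \<and> z \<le> y)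
        \<and> (\<forall>x\<in>D. 0 \<le> x) \<and> (\<forall>l. (\<forall>x\<in>D. l \<le> x) \<longrightarrow> l \<le> 0)
      \<longrightarrow> (\<forall>\<epsilon>>0. \<exists>d0\<in>D. \<forall>d\<in>D. d \<le> d0 \<longrightarrow> norm d < \<epsilon>))"

definition un_topology :: "'a::{banach, ordered_real_vector, lattice} topology" where
  "un_topology = topology (\<lambda>U. \<forall>x\<in>U. \<exists>\<epsilon>>0. \<exists>w\<ge>0.
       {y. norm (inf (labs (y - x)) w) < \<epsilon>} \<subseteq> U)"

type_synonym 'x sx = "('x set \<times> ('x \<Rightarrow> real)) set"

definition sx_reps :: "'x topology \<Rightarrow> ('x set \<times> ('x \<Rightarrow> real)) set" where
  "sx_reps X = {(U, f). openin X U \<and> X closure_of U = topspace X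
                 \<and> continuous_map (subtopology X U) euclideanreal f}"

definition sx_eq :: "'x topology \<Rightarrow> (('x set \<times> ('x \<Rightarrow> real)) \<times> ('x set \<times> ('x \<Rightarrow> real))) set" where
  "sx_eq X = {((U, f), (V, g)). (U, f) \<in> sx_reps X \<and> (V, g) \<in> sx_reps X
                 \<and> (\<forall>x\<in>U \<inter> V. f x = g x)}"

definition SX :: "'x topology \<Rightarrow> 'x sx set" where
  "SX X = sx_reps X // sx_eq X"

definition sx_lift1 :: "'x topology \<Rightarrow> (real \<Rightarrow> real) \<Rightarrow> 'x sx \<Rightarrow> 'x sx" where
  "sx_lift1 X F a = {(W, h) \<in> sx_reps X. \<exists>(U, f)\<in>a. \<forall>x\<in>W \<inter> U. h x = F (f x)}"

definition sx_lift2 :: "'x topology \<Rightarrow> (real \<Rightarrow> real \<Rightarrow> real) \<Rightarrow> 'x sx \<Rightarrow> 'x sx \<Rightarrow> 'x sx" where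
  "sx_lift2 X F a b = {(W, h) \<in> sx_reps X. \<exists>(U, f)\<in>a. \<exists>(V, g)\<in>b.
       \<forall>x\<in>W \<inter> U \<inter> V. h x = F (f x) (g x)}"

definition sx_const :: "'x topology \<Rightarrow> real \<Rightarrow> 'x sx" where
  "sx_const X c = {(W, h) \<in> sx_reps X. \<forall>x\<in>W. h x = c}"

definition sx_zero :: "'x topology \<Rightarrow> 'x sx" where
  "sx_zero X = sx_const X 0"

definition sx_add :: "'x topology \<Rightarrow> 'x sx \<Rightarrow> 'x sx \<Rightarrow> 'x sx" where
  "sx_add X = sx_lift2 X (+)"

definition sx_diff :: "'x topology \<Rightarrow> 'x sx \<Rightarrow> 'x sx \<Rightarrow> 'x sx" where
  "sx_diff X = sx_lift2 X (-)"

definition sx_scale :: "'x topology \<Rightarrow> real \<Rightarrow> 'x sx \<Rightarrow> 'x sx" where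
  "sx_scale X c = sx_lift1 X (\<lambda>t. c * t)"

definition sx_sup :: "'x topology \<Rightarrow> 'x sx \<Rightarrow> 'x sx \<Rightarrow> 'x sx" where
  "sx_sup X = sx_lift2 X max"

definition sx_inf :: "'x topology \<Rightarrow> 'x sx \<Rightarrow> 'x sx \<Rightarrow> 'x sx" where
  "sx_inf X = sx_lift2 X min"

definition sx_abs :: "'x topology \<Rightarrow> 'x sx \<Rightarrow> 'x sx" where
  "sx_abs X = sx_lift1 X abs"

definition sx_le :: "'x topology \<Rightarrow> 'x sx \<Rightarrow> 'x sx \<Rightarrow> bool" where
  "sx_le X a b \<longleftrightarrow> (\<forall>(U, f)\<in>a. \<forall>(V, g)\<in>b. \<forall>x\<in>U \<inter> V. f x \<le> g x)"

definition sx_lt :: "'x topology \<Rightarrow> 'x sx \<Rightarrow> 'x sx \<Rightarrow> bool" where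
  "sx_lt X a b \<longleftrightarrow> sx_le X a b \<and> a \<noteq> b"

definition sx_lattice_hom :: "'x topology \<Rightarrow> ('a::{banach, ordered_real_vector, lattice} \<Rightarrow> 'x sx) \<Rightarrow> bool" where
  "sx_lattice_hom X T \<longleftrightarrow>
     (\<forall>x. T x \<in> SX X) \<and>
     (\<forall>x y. T (x + y) = sx_add X (T x) (T y)) \<and>
     (\<forall>c x. T (c *\<^sub>R x) = sx_scale X c (T x)) \<and>
     (\<forall>x y. T (sup x y) = sx_sup X (T x) (T y)) \<and>
     (\<forall>x y. T (inf x y) = sx_inf X (T x) (T y))"

definition sx_ideal :: "'x topology \<Rightarrow> 'x sx set \<Rightarrow> bool" where
  "sx_ideal X I \<longleftrightarrow> I \<subseteq> SX X \<and> sx_zero X \<in> I \<and>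
     (\<forall>a\<in>I. \<forall>b\<in>I. sx_add X a b \<in> I) \<and>
     (\<forall>c. \<forall>a\<in>I. sx_scale X c a \<in> I) \<and>
     (\<forall>a\<in>SX X. \<forall>b\<in>I. sx_le X (sx_abs X a) (sx_abs X b) \<longrightarrow> a \<in> I)"

definition sx_order_dense :: "'x topology \<Rightarrow> 'x sx set \<Rightarrow> bool" where
  "sx_order_dense X I \<longleftrightarrow>
     (\<forall>a\<in>SX X. sx_lt X (sx_zero X) a \<longrightarrow> (\<exists>b\<in>I. sx_lt X (sx_zero X) b \<and> sx_le X b a))"

definition ext_un_topology :: "'x topology \<Rightarrow> 'x sx set \<Rightarrow> ('x sx \<Rightarrow> real) \<Rightarrow> 'x sx topology" where
  "ext_un_topology X I N = topology (\<lambda>U. U \<subseteq> SX X \<and>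
     (\<forall>y\<in>U. \<exists>\<epsilon>>0. \<exists>w\<in>I. sx_le X (sx_zero X) w \<and>
        {z\<in>SX X. N (sx_inf X (sx_abs X (sx_diff X z y)) w) < \<epsilon>} \<subseteq> U))"

end

theory Submission
  imports Defs "HOL-Library.Lattice_Algebras"
begin

text \<open>The points of the representing space are the ultrafilters of the lattice of positive elements
  of \<open>E\<close>. Each of them induces a total order on \<open>E\<close>, in which an element \<open>x\<close> can be compared with
  the multiples of a unit \<open>e\<close> from a maximal disjoint family; the resulting Dedekind cut is the value
  of \<open>x\<close> at the point. The Archimedean property makes these values finite on an open dense set and
  the image order dense in \<open>S(X)\<close>. An order continuous norm makes \<open>E\<close> Dedekind complete, and an order
  dense Dedekind complete sublattice is an ideal: an element \<open>a\<close> of \<open>S(X)\<close> between \<open>0\<close> and \<open>T b\<close> is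
  the image of the supremum of all \<open>x\<close> with \<open>T x \<le> a\<close>. For an ideal, the truncations
  \<open>|z - y| \<and> T w\<close> come from \<open>E\<close> and satisfy the triangle inequality, so that un-balls around points
  of \<open>T(E)\<close> extend to open sets of \<open>S(X)\<close>.\<close>

section \<open>Vector lattices\<close>

text \<open>The order that an ultrafilter induces is total but not Archimedean: relative to a unit
  \<open>e\<close> it may contain infinitely large and infinitesimal elements. Infinitely large ones
  have no real value, which is why the image consists of functions on dense open sets and not on all
  of the space. Infinitesimal ones are lost in the cut, so a point where \<open>x - y\<close> is
  positive need not separate the values of \<open>x\<close> and \<open>y\<close>; injectivity has to
  produce a point where the difference exceeds a fixed multiple of \<open>e\<close>. A disjoint
  family replaces a single weak unit, which \<open>E\<close> may lack: two disjoint elements are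
  never positive at the same point, so the unit used at a point is determined. Order continuity
  enters through suprema of order bounded sets closed under binary suprema. In the topological part
  the delicate direction is openness of \<open>T\<close>: an open subset of \<open>E\<close> has to
  be exhibited as the trace of an open subset of the much larger S(X).\<close>

interpretation lgroup: lattice_ab_group_add
  "(+)" "0::'a::{ordered_ab_group_add,lattice}" "(-)" uminus "(\<le>)" "(<)" inf sup ..

text \<open>Lattice-ordered groups are distributive: \<open>t = inf x t + sup x t - x\<close> turns
  a bound on \<open>inf x t\<close> into a bound on \<open>t\<close>, the bounds for
  \<open>y\<close> and \<open>z\<close> pass to \<open>sup y z\<close>, and the same identity
  converts back.\<close>

lemma lgroup_inf_sup_le:
  fixes x y z :: "'a::{ordered_ab_group_add,lattice}"
  shows "inf x (sup y z) \<le> sup (inf x y) (inf x z)"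
proof -
  let ?w = "sup (inf x y) (inf x z)" and ?s = "sup y z"
  have *: "t \<le> ?w + sup x ?s - x" if "t \<le> ?s" "inf x t \<le> ?w" for t
  proof -
    have "t + x = sup x t + inf x t"
      using lgroup.add_eq_inf_sup[of x t] by (simp add: add.commute)
    also have "\<dots> \<le> sup x ?s + ?w"
      by (intro add_mono sup_mono order_refl that)
    finally show ?thesis by (simp add: le_diff_eq add.commute)
  qed
  have "?s \<le> ?w + sup x ?s - x"
    by (rule sup_least; rule *) auto
  moreover have "inf x ?s = x + ?s - sup x ?s"
    using lgroup.add_eq_inf_sup[of x ?s] by (metis add_diff_cancel_left')
  ultimately show ?thesis
    by (metis add.commute diff_le_eq le_diff_eq)
qed

text \<open>The reverse inequality is immediate, so positive parts commute with meets. This carries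
  the filter property from positive elements to \<open>positive_at\<close> on all of
  \<open>E\<close>.\<close>

lemma lgroup_inf_pos_part_le:
  fixes x y :: "'a::{ordered_ab_group_add,lattice}"
  shows "inf (sup x 0) (sup y 0) \<le> sup (inf x y) 0"
proof -
  have "inf (sup x 0) (sup y 0) \<le> sup (inf (sup x 0) y) (inf (sup x 0) 0)"
    by (rule lgroup_inf_sup_le)
  also have "\<dots> \<le> sup (sup (inf y x) (inf y 0)) 0"
    using lgroup_inf_sup_le[of y x 0] by (intro sup_mono) (auto simp: inf.commute)
  also have "\<dots> \<le> sup (inf x y) 0"
    by (auto simp: inf.commute intro: le_supI1 le_supI2)
  finally show ?thesis .
qed

text \<open>By translation invariance the right side is the infimum of \<open>u + u\<close>,
  \<open>u + w\<close>, \<open>v + u\<close> and \<open>v + w\<close>, each of which dominates the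
  left side.\<close>

lemma lgroup_inf_add_le:
  fixes u v w :: "'a::{ordered_ab_group_add,lattice}"
  assumes "0 \<le> u" "0 \<le> v" "0 \<le> w"
  shows "inf u (v + w) \<le> inf u v + inf u w"
proof -
  have "inf u (v + w) \<le> u + u" "inf u (v + w) \<le> u + w" "inf u (v + w) \<le> v + u"
    using assms by (auto intro: le_infI1 add_increasing add_increasing2)
  then show ?thesis
    by (simp add: lgroup.add_inf_distrib_left lgroup.add_inf_distrib_right)
qed

lemma scaleR_sup:
  fixes x y :: "'a::{ordered_real_vector,lattice}"
  assumes "0 < c"
  shows "c *\<^sub>R sup x y = sup (c *\<^sub>R x) (c *\<^sub>R y)"
proof (rule order_antisym)
  have "(1/c) *\<^sub>R (c *\<^sub>R z) \<le> (1/c) *\<^sub>R sup (c *\<^sub>R x) (c *\<^sub>R y)" if "z = x \<or> z = y" for z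
    using that assms by (intro scaleR_left_mono) auto
  then have "sup x y \<le> (1/c) *\<^sub>R sup (c *\<^sub>R x) (c *\<^sub>R y)"
    using assms by simp
  then have "c *\<^sub>R sup x y \<le> c *\<^sub>R ((1/c) *\<^sub>R sup (c *\<^sub>R x) (c *\<^sub>R y))"
    using assms by (intro scaleR_left_mono) auto
  then show "c *\<^sub>R sup x y \<le> sup (c *\<^sub>R x) (c *\<^sub>R y)"
    using assms by simp
  show "sup (c *\<^sub>R x) (c *\<^sub>R y) \<le> c *\<^sub>R sup x y"
    using assms by (intro sup_least scaleR_left_mono) auto
qed

lemma scaleR_pos_part:
  fixes x :: "'a::{ordered_real_vector,lattice}"
  assumes "0 < c"
  shows "sup (c *\<^sub>R x) 0 = c *\<^sub>R sup x 0"
  using scaleR_sup[OF assms, of x 0] by simp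

section \<open>The Archimedean property and suprema in Banach lattices\<close>

definition archimedean :: "'a::{ordered_real_vector,lattice} itself \<Rightarrow> bool" where
  "archimedean _ \<longleftrightarrow> (\<forall>x y::'a. (\<forall>n::nat. real n *\<^sub>R x \<le> y) \<longrightarrow> x \<le> 0)"

lemma labs_nonneg_eq:
  fixes x :: "'a::{ordered_ab_group_add,lattice}"
  assumes "0 \<le> x" shows "labs x = x"
proof -
  have "- x \<le> x" using assms by (meson neg_le_0_iff_le order_trans)
  then show ?thesis by (simp add: labs_def sup_absorb1)
qed

lemma labs_nonneg:
  fixes x :: "'a::{ordered_ab_group_add,lattice}"
  shows "0 \<le> labs x"
proof -
  have "0 \<le> labs x + labs x"
    using add_mono[of x "labs x" "- x" "labs x"] by (simp add: labs_def)
  then show ?thesis by simp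
qed

lemma labs_labs:
  fixes x :: "'a::{ordered_ab_group_add,lattice}"
  shows "labs (labs x) = labs x"
  by (simp add: labs_nonneg labs_nonneg_eq)

lemma banach_lattice_norm_mono:
  fixes x y :: "'a::{banach, ordered_real_vector, lattice}"
  assumes "banach_lattice TYPE('a)" "0 \<le> x" "x \<le> y"
  shows "norm x \<le> norm y"
  using assms labs_nonneg_eq[of x] labs_nonneg_eq[of y]
  unfolding banach_lattice_def by (metis order_trans)

lemma banach_lattice_norm_labs:
  fixes x :: "'a::{banach, ordered_real_vector, lattice}"
  assumes "banach_lattice TYPE('a)"
  shows "norm (labs x) = norm x"
  using assms labs_labs[of x] unfolding banach_lattice_def by (metis order_antisym order_refl)

text \<open>The norm is monotone only on moduli, so the inequality first passes to positive parts;
  then \<open>real n * norm (sup x 0)\<close> is bounded uniformly in \<open>n\<close>.\<close>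

lemma banach_lattice_archimedean:
  assumes bl: "banach_lattice TYPE('a::{banach, ordered_real_vector, lattice})"
  shows "archimedean TYPE('a)"
  unfolding archimedean_def
proof (intro allI impI)
  fix x y :: 'a
  assume le: "\<forall>n::nat. real n *\<^sub>R x \<le> y"
  have "real n * norm (sup x 0) \<le> norm (sup y 0)" for n
  proof (cases "n = 0")
    case False
    have "real n *\<^sub>R sup x 0 = sup (real n *\<^sub>R x) 0"
      using False by (simp add: scaleR_pos_part)
    also have "\<dots> \<le> sup y 0" using le by (intro sup_mono) auto
    finally have "norm (real n *\<^sub>R sup x 0) \<le> norm (sup y 0)"
      by (intro banach_lattice_norm_mono[OF bl] scaleR_nonneg_nonneg) auto
    then show ?thesis by simp
  qed simp
  then have "norm (sup x 0) = 0"
    by (metis real_archimedian_rdiv_eq_0 norm_ge_zero)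
  then show "x \<le> 0" by (metis norm_eq_zero sup_ge1)
qed

text \<open>Order continuity yields pairs of a member \<open>x n\<close> of \<open>S\<close> and an
  upper bound \<open>y n\<close> at arbitrarily small norm distance. Any such \<open>x\<close> is a
  Cauchy sequence, and norm completeness supplies the supremum as its limit.\<close>

lemma order_continuous_directed_sup:
  fixes S :: "'a::{banach, ordered_real_vector, lattice} set"
  assumes bl: "banach_lattice TYPE('a)" and oc: "order_continuous TYPE('a)"
    and "x0 \<in> S" and bdd: "\<And>x. x \<in> S \<Longrightarrow> x \<le> b"
    and sup: "\<And>x y. x \<in> S \<Longrightarrow> y \<in> S \<Longrightarrow> sup x y \<in> S"
  shows "\<exists>m. (\<forall>x\<in>S. x \<le> m) \<and> (\<forall>y. (\<forall>x\<in>S. x \<le> y) \<longrightarrow> m \<le> y)"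
proof -
  define B where "B = {y. \<forall>x\<in>S. x \<le> y}"
  define D where "D = {y - x | x y. x \<in> S \<and> y \<in> B}"
  \<comment> \<open>\<open>D\<close> decreases to \<open>0\<close>, hence contains elements of arbitrarily small norm.\<close>
  have bB: "b \<in> B" using bdd by (auto simp: B_def)
  have ne: "D \<noteq> {}" using bB \<open>x0 \<in> S\<close> by (auto simp: D_def)
  have dir: "\<exists>z\<in>D. z \<le> d1 \<and> z \<le> d2" if d: "d1 \<in> D" "d2 \<in> D" for d1 d2
  proof -
    obtain x1 y1 x2 y2 where eq: "d1 = y1 - x1" "d2 = y2 - x2"
      and mem: "x1 \<in> S" "y1 \<in> B" "x2 \<in> S" "y2 \<in> B"
      using d by (auto simp: D_def)
    have "inf y1 y2 \<in> B" "sup x1 x2 \<in> S" using mem sup by (auto simp: B_def)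
    then have "inf y1 y2 - sup x1 x2 \<in> D" unfolding D_def by blast
    moreover have "inf y1 y2 - sup x1 x2 \<le> d1" "inf y1 y2 - sup x1 x2 \<le> d2"
      unfolding eq by (rule diff_mono; simp)+
    ultimately show ?thesis by blast
  qed
  have nonneg: "0 \<le> d" if "d \<in> D" for d
    using that by (auto simp: D_def B_def)
  have glb: "l \<le> 0" if l: "\<forall>d\<in>D. l \<le> d" for l
  proof -
    \<comment> \<open>A lower bound \<open>l\<close> of \<open>D\<close> may be subtracted from any
      upper bound without leaving \<open>B\<close>. Iterating from \<open>b\<close> gives
      \<open>real n *\<^sub>R l \<le> b - x0\<close> for all \<open>n\<close>, and the Archimedean
      property applies.\<close>
    have step: "y - l \<in> B" if "y \<in> B" for y
    proof -
      have "x \<le> y - l" if "x \<in> S" for x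
      proof -
        have "l \<le> y - x" using l \<open>y \<in> B\<close> that by (auto simp: D_def)
        then show ?thesis by (simp add: algebra_simps)
      qed
      then show ?thesis by (simp add: B_def)
    qed
    have B: "b - real n *\<^sub>R l \<in> B" for n
    proof (induction n)
      case (Suc n)
      then show ?case using step[OF Suc] by (simp add: algebra_simps)
    qed (simp add: bB)
    have "real n *\<^sub>R l \<le> b - x0" for n
    proof -
      have "x0 \<le> b - real n *\<^sub>R l" using \<open>x0 \<in> S\<close> B[of n] by (simp add: B_def)
      then show ?thesis by (simp only: le_diff_eq add.commute)
    qed
    then show "l \<le> 0"
      using banach_lattice_archimedean[OF bl] unfolding archimedean_def by blast
  qed
  have "\<forall>\<epsilon>>0. \<exists>d0\<in>D. \<forall>d\<in>D. d \<le> d0 \<longrightarrow> norm d < \<epsilon>"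
    by (rule oc[unfolded order_continuous_def, THEN spec[where x = D], THEN mp])
      (use ne dir nonneg glb in blast)
  then have small: "\<exists>d\<in>D. norm d < \<epsilon>" if "\<epsilon> > 0" for \<epsilon>
    using that by (meson order_refl)
  have "\<exists>x y. x \<in> S \<and> y \<in> B \<and> norm (y - x) < 1 / real (Suc n)" for n
    using small[of "1 / real (Suc n)"] by (auto simp: D_def)
  then obtain x y where xS: "\<And>n. x n \<in> S" and yB: "\<And>n. y n \<in> B"
    and xy: "\<And>n. norm (y n - x n) < 1 / real (Suc n)"
    by metis
  \<comment> \<open>The pairs are chosen independently, but each \<open>x\<close> lies below both
    \<open>y\<close>, so the two gaps control the difference.\<close>
  have gap: "labs (x n - x m) \<le> (y n - x n) + (y m - x m)" for n m
  proof -
    have "x n \<le> y m" "x m \<le> y n" "x n \<le> y n" "x m \<le> y m"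
      using xS yB by (auto simp: B_def)
    then have "x n - x m \<le> y m - x m" "x m - x n \<le> y n - x n" "0 \<le> y n - x n" "0 \<le> y m - x m"
      by (auto intro: diff_right_mono)
    then show ?thesis
      by (auto simp: labs_def intro: add_increasing add_increasing2)
  qed
  have dist: "norm (x n - x m) \<le> 1 / real (Suc n) + 1 / real (Suc m)" for n m
  proof -
    have "norm (x n - x m) = norm (labs (x n - x m))"
      by (simp add: banach_lattice_norm_labs[OF bl])
    also have "\<dots> \<le> norm ((y n - x n) + (y m - x m))"
      by (rule banach_lattice_norm_mono[OF bl labs_nonneg gap])
    also have "\<dots> \<le> norm (y n - x n) + norm (y m - x m)" by (rule norm_triangle_ineq)
    finally show ?thesis using xy[of n] xy[of m] by linarith
  qed
  have "Cauchy x"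
  proof (rule CauchyI)
    fix e :: real assume "0 < e"
    then obtain M where M: "1 / real (Suc M) < e / 2"
      using nat_approx_posE[of "e/2"] by auto
    have "norm (x m - x n) < e" if "M \<le> m" "M \<le> n" for m n
    proof -
      have "1 / real (Suc m) \<le> 1 / real (Suc M)" "1 / real (Suc n) \<le> 1 / real (Suc M)"
        using that by (auto intro!: divide_left_mono)
      then show ?thesis using dist[of m n] M by linarith
    qed
    then show "\<exists>M. \<forall>m\<ge>M. \<forall>n\<ge>M. norm (x m - x n) < e" by blast
  qed
  then obtain m where m: "x \<longlonglongrightarrow> m"
    using Cauchy_convergent convergent_def by blast
  \<comment> \<open>Both halves of the least upper bound property are brought to this form, with
    \<open>z\<close> equal to \<open>s - m\<close> or \<open>m - t\<close>: the bound tends to 0 in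
    norm, hence the positive part of \<open>z\<close> vanishes.\<close>
  have lim: "z \<le> 0" if "\<And>n. z \<le> labs (m - x n) + (y n - x n)" for z
  proof -
    have nn: "0 \<le> y n - x n" for n using xS yB by (auto simp: B_def)
    have "norm (sup z 0) \<le> norm (x n - m) + 1 / real (Suc n)" for n
    proof -
      have "sup z 0 \<le> labs (m - x n) + (y n - x n)"
        using that nn labs_nonneg by (intro sup_least add_nonneg_nonneg)
      then have "norm (sup z 0) \<le> norm (labs (m - x n) + (y n - x n))"
        by (intro banach_lattice_norm_mono[OF bl]) auto
      also have "\<dots> \<le> norm (m - x n) + norm (y n - x n)"
        using norm_triangle_ineq banach_lattice_norm_labs[OF bl] by metis
      finally show ?thesis using xy[of n] by (simp add: norm_minus_commute)
    qed
    moreover have "(\<lambda>n. norm (x n - m) + 1 / real (Suc n)) \<longlonglongrightarrow> 0 + 0"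
    proof (rule tendsto_add)
      show "(\<lambda>n. norm (x n - m)) \<longlonglongrightarrow> 0"
        using m by (simp add: LIM_zero tendsto_norm_zero)
      show "(\<lambda>n. 1 / real (Suc n)) \<longlonglongrightarrow> 0"
        using LIMSEQ_inverse_real_of_nat by (simp add: inverse_eq_divide)
    qed
    ultimately have "norm (sup z 0) \<le> 0"
      by (intro LIMSEQ_le_const[where x = 0]) auto
    then show "z \<le> 0" by (metis norm_le_zero_iff sup_ge1)
  qed
  have "s \<le> m" if "s \<in> S" for s
  proof -
    have "s - m \<le> labs (m - x n) + (y n - x n)" for n
    proof -
      have "s \<le> y n" "x n - m \<le> labs (m - x n)"
        using that yB by (auto simp: B_def labs_def)
      then have "s + (x n - m) \<le> y n + labs (m - x n)" by (rule add_mono)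
      then show ?thesis by (simp add: algebra_simps)
    qed
    then show ?thesis using lim[of "s - m"] by simp
  qed
  moreover have "m \<le> t" if "\<forall>s\<in>S. s \<le> t" for t
  proof -
    have "m - t \<le> labs (m - x n) + (y n - x n)" for n
    proof -
      have "x n \<le> t" "x n \<le> y n" "m - x n \<le> labs (m - x n)"
        using that xS yB by (auto simp: B_def labs_def)
      then have "(m - x n) + x n + x n \<le> labs (m - x n) + t + y n" by (intro add_mono)
      then show ?thesis by (simp add: algebra_simps)
    qed
    then show ?thesis using lim[of "m - t"] by simp
  qed
  ultimately show ?thesis by blast
qed

section \<open>Continuous functions on open dense subsets\<close>

text \<open>For a representative \<open>(U, f)\<close> this is its class under \<open>sx_eq\<close>.
  All computations in S(X) go through it, so the quotient itself appears only in
  \<open>SX_iff\<close>.\<close>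

definition sx_class :: "'x topology \<Rightarrow> 'x set \<Rightarrow> ('x \<Rightarrow> real) \<Rightarrow> 'x sx" where
  "sx_class X U f = {(W, h) \<in> sx_reps X. \<forall>x\<in>W \<inter> U. h x = f x}"

lemma dense_open_Int:
  assumes "openin X U" "X closure_of U = topspace X" "openin X V" "X closure_of V = topspace X"
  shows "openin X (U \<inter> V)" "X closure_of (U \<inter> V) = topspace X"
proof -
  show "openin X (U \<inter> V)" using assms by blast
  have "X closure_of (U \<inter> X closure_of V) = X closure_of (U \<inter> V)"
    by (rule closure_of_openin_Int_closure_of) fact
  then show "X closure_of (U \<inter> V) = topspace X"
    using assms openin_subset[of X U] by (simp add: inf_absorb1)
qed

definition dense_open :: "'x topology \<Rightarrow> 'x set \<Rightarrow> bool" where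
  "dense_open X U \<longleftrightarrow> openin X U \<and> X closure_of U = topspace X"

lemma dense_openD:
  assumes "dense_open X U" shows "openin X U" "X closure_of U = topspace X"
  using assms by (auto simp: dense_open_def)

lemma dense_open_IntI: "dense_open X U \<Longrightarrow> dense_open X V \<Longrightarrow> dense_open X (U \<inter> V)"
  using dense_open_Int unfolding dense_open_def by blast

text \<open>The agreement set of two continuous real functions is closed, and openness of
  \<open>W\<close> makes \<open>W \<inter> D\<close> dense in \<open>W\<close>.\<close>

lemma continuous_map_eq_on_dense:
  fixes f g :: "'x \<Rightarrow> real"
  assumes "openin X W" "X closure_of D = topspace X"
    and "continuous_map (subtopology X W) euclideanreal f"
    and "continuous_map (subtopology X W) euclideanreal g"
    and eq: "\<And>x. x \<in> W \<inter> D \<Longrightarrow> f x = g x" and "x \<in> W"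
  shows "f x = g x"
proof (rule forall_in_closure_of_eq[where X = "subtopology X W" and S = "W \<inter> D" and Y = euclideanreal])
  have W: "W \<subseteq> topspace X" by (rule openin_subset) fact
  have "X closure_of (W \<inter> X closure_of D) = X closure_of (W \<inter> D)"
    by (rule closure_of_openin_Int_closure_of) fact
  then have "W \<subseteq> X closure_of (W \<inter> D)"
    using assms(2) W closure_of_subset[OF W] by (simp add: inf_absorb1)
  then show "x \<in> subtopology X W closure_of (W \<inter> D)"
    using \<open>x \<in> W\<close> by (auto simp: closure_of_subtopology)
qed (use assms in \<open>auto simp: Hausdorff_space_euclidean\<close>)

lemma sx_repsD:
  assumes "(U, f) \<in> sx_reps X"
  shows "openin X U" "X closure_of U = topspace X" "continuous_map (subtopology X U) euclideanreal f"
  using assms by (auto simp: sx_reps_def)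

lemma sx_reps_dense_open: "(U, f) \<in> sx_reps X \<Longrightarrow> dense_open X U"
  by (simp add: sx_reps_def dense_open_def)

lemma sx_reps_restrict:
  assumes "(U, f) \<in> sx_reps X" "V \<subseteq> U"
  shows "continuous_map (subtopology X V) euclideanreal f"
  using assms by (auto simp: sx_reps_def intro: continuous_map_from_subtopology_mono)

lemma sx_reps_eq_on_dense:
  assumes "(U, f) \<in> sx_reps X" "(V, g) \<in> sx_reps X" "X closure_of D = topspace X"
    and "\<And>x. x \<in> U \<inter> V \<inter> D \<Longrightarrow> f x = g x" and "x \<in> U \<inter> V"
  shows "f x = g x"
proof (rule continuous_map_eq_on_dense[where D = D and W = "U \<inter> V"])
  show "openin X (U \<inter> V)" using assms(1,2) by (auto dest: sx_repsD)
qed (use assms sx_reps_restrict[OF assms(1)] sx_reps_restrict[OF assms(2)] in auto)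

lemma sx_reps_le_on_dense:
  assumes "(U, f) \<in> sx_reps X" "(V, g) \<in> sx_reps X" "X closure_of D = topspace X"
    and "\<And>x. x \<in> U \<inter> V \<inter> D \<Longrightarrow> f x \<le> g x" and "x \<in> U \<inter> V"
  shows "f x \<le> g x"
proof -
  have "max (f x) (g x) = g x"
  proof (rule continuous_map_eq_on_dense[where D = D and W = "U \<inter> V" and f = "\<lambda>x. max (f x) (g x)"])
    show "openin X (U \<inter> V)" using assms(1,2) by (auto dest: sx_repsD)
  qed (use assms sx_reps_restrict[OF assms(1)] sx_reps_restrict[OF assms(2)] in \<open>auto intro!: continuous_map_real_max\<close>)
  then show ?thesis by simp
qed

lemma sx_class_self:
  "(U, f) \<in> sx_reps X \<Longrightarrow> (U, f) \<in> sx_class X U f"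
  by (simp add: sx_class_def)

text \<open>The dense set \<open>D\<close> is a free parameter so that an equation can be checked
  only where the auxiliary representatives occurring in its proof are defined as well.\<close>

lemma sx_class_eqI:
  assumes f: "(U, f) \<in> sx_reps X" and g: "(V, g) \<in> sx_reps X"
    and D: "X closure_of D = topspace X"
    and eq: "\<And>x. x \<in> U \<inter> V \<inter> D \<Longrightarrow> f x = g x"
  shows "sx_class X U f = sx_class X V g"
proof -
  have fg: "f x = g x" if "x \<in> U \<inter> V" for x
    by (rule sx_reps_eq_on_dense[OF f g D eq that])
  have "h x = g x" if h: "(W, h) \<in> sx_reps X" and "\<forall>x\<in>W \<inter> U. h x = f x" "x \<in> W \<inter> V" for W h x
    by (rule sx_reps_eq_on_dense[OF h g sx_repsD(2)[OF f]]) (use that fg in auto)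
  moreover
  have "h x = f x" if h: "(W, h) \<in> sx_reps X" and "\<forall>x\<in>W \<inter> V. h x = g x" "x \<in> W \<inter> U" for W h x
    by (rule sx_reps_eq_on_dense[OF h f sx_repsD(2)[OF g]]) (use that fg in auto)
  ultimately show ?thesis
    by (intro subset_antisym subrelI; unfold sx_class_def; blast)
qed

lemma sx_class_eqD:
  assumes "(U, f) \<in> sx_reps X" "sx_class X U f = sx_class X V g" "x \<in> U \<inter> V"
  shows "f x = g x"
  using sx_class_self[OF assms(1)] assms(2,3) by (auto simp: sx_class_def)

lemma SX_iff: "a \<in> SX X \<longleftrightarrow> (\<exists>U f. (U, f) \<in> sx_reps X \<and> a = sx_class X U f)"
proof -
  have "sx_eq X `` {(U, f)} = sx_class X U f" if "(U, f) \<in> sx_reps X" for U f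
    using that by (auto simp: sx_eq_def sx_class_def)
  then show ?thesis unfolding SX_def quotient_def by auto blast
qed

lemma sx_class_in_SX [simp]: "(U, f) \<in> sx_reps X \<Longrightarrow> sx_class X U f \<in> SX X"
  by (auto simp: SX_iff)

lemma sx_reps_comp1:
  assumes "(U, f) \<in> sx_reps X" "continuous_on UNIV F"
  shows "(U, \<lambda>x. F (f x)) \<in> sx_reps X"
  using assms continuous_map_compose[of "subtopology X U" euclideanreal f euclideanreal F]
  by (auto simp: sx_reps_def o_def)

lemma sx_reps_comp2:
  assumes "(U, f) \<in> sx_reps X" "(V, g) \<in> sx_reps X" "continuous_on UNIV (\<lambda>(s, t). F s t)"
  shows "(U \<inter> V, \<lambda>x. F (f x) (g x)) \<in> sx_reps X"
proof -
  have "continuous_map (subtopology X (U \<inter> V)) euclidean (\<lambda>x. (f x, g x))"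
    using continuous_map_pairedI[of "subtopology X (U \<inter> V)" euclideanreal f euclideanreal g]
      sx_reps_restrict[OF assms(1)] sx_reps_restrict[OF assms(2)]
    by (simp add: euclidean_product_topology)
  then have "continuous_map (subtopology X (U \<inter> V)) euclideanreal ((\<lambda>(s, t). F s t) \<circ> (\<lambda>x. (f x, g x)))"
    by (rule continuous_map_compose) (use assms(3) in simp)
  then show ?thesis
    using assms(1,2) dense_open_Int[of X U V] by (auto simp: sx_reps_def o_def)
qed

text \<open>\<open>sx_lift1\<close> asks for agreement with one representative, on the domain of
  that one. Density of this domain spreads the equation to \<open>W \<inter> U\<close>, so the
  choice is immaterial.\<close>

lemma sx_lift1_class:
  assumes f: "(U, f) \<in> sx_reps X" and F: "continuous_on UNIV F"
  shows "sx_lift1 X F (sx_class X U f) = sx_class X U (\<lambda>x. F (f x))"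
proof -
  have key: "h x = F (f x)"
    if h: "(W, h) \<in> sx_reps X" and g: "(V, g) \<in> sx_class X U f"
      and eq: "\<forall>x\<in>W \<inter> V. h x = F (g x)" and x: "x \<in> W \<inter> U" for W h V g x
  proof -
    have "(V, g) \<in> sx_reps X" using g by (simp add: sx_class_def)
    note D = sx_repsD(2)[OF this]
    show ?thesis
      by (rule sx_reps_eq_on_dense[OF h sx_reps_comp1[OF f F] D _ x])
        (use eq g in \<open>auto simp: sx_class_def\<close>)
  qed
  show ?thesis
  proof (rule subset_antisym; rule subrelI)
    fix W h
    assume "(W, h) \<in> sx_lift1 X F (sx_class X U f)"
    then obtain V g where "(W, h) \<in> sx_reps X" "(V, g) \<in> sx_class X U f" "\<forall>x\<in>W \<inter> V. h x = F (g x)"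
      unfolding sx_lift1_def by blast
    then show "(W, h) \<in> sx_class X U (\<lambda>x. F (f x))"
      using key unfolding sx_class_def[of X U "\<lambda>x. F (f x)"] by blast
  next
    fix W h
    assume "(W, h) \<in> sx_class X U (\<lambda>x. F (f x))"
    then show "(W, h) \<in> sx_lift1 X F (sx_class X U f)"
      using sx_class_self[OF f] unfolding sx_lift1_def sx_class_def[of X U "\<lambda>x. F (f x)"] by blast
  qed
qed

lemma sx_lift2_class:
  assumes f: "(U, f) \<in> sx_reps X" and g: "(V, g) \<in> sx_reps X"
    and F: "continuous_on UNIV (\<lambda>(s, t). F s t)"
  shows "sx_lift2 X F (sx_class X U f) (sx_class X V g) = sx_class X (U \<inter> V) (\<lambda>x. F (f x) (g x))"
proof -
  have key: "h x = F (f x) (g x)"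
    if h: "(W, h) \<in> sx_reps X" and f': "(U', f') \<in> sx_class X U f" and g': "(V', g') \<in> sx_class X V g"
      and eq: "\<forall>x\<in>W \<inter> U' \<inter> V'. h x = F (f' x) (g' x)" and x: "x \<in> W \<inter> (U \<inter> V)" for W h U' f' V' g' x
  proof -
    have r: "(U', f') \<in> sx_reps X" "(V', g') \<in> sx_reps X" using f' g' by (auto simp: sx_class_def)
    note D = dense_open_Int(2)[OF sx_repsD(1,2)[OF r(1)] sx_repsD(1,2)[OF r(2)]]
    show ?thesis
      by (rule sx_reps_eq_on_dense[OF h sx_reps_comp2[OF f g F] D _ x])
        (use eq f' g' in \<open>auto simp: sx_class_def\<close>)
  qed
  show ?thesis
  proof (rule subset_antisym; rule subrelI)
    fix W h
    assume "(W, h) \<in> sx_lift2 X F (sx_class X U f) (sx_class X V g)"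
    then obtain U' f' V' g' where "(W, h) \<in> sx_reps X" "(U', f') \<in> sx_class X U f"
      "(V', g') \<in> sx_class X V g" "\<forall>x\<in>W \<inter> U' \<inter> V'. h x = F (f' x) (g' x)"
      unfolding sx_lift2_def by blast
    then show "(W, h) \<in> sx_class X (U \<inter> V) (\<lambda>x. F (f x) (g x))"
      using key unfolding sx_class_def[of X "U \<inter> V" "\<lambda>x. F (f x) (g x)"] by blast
  next
    fix W h
    assume "(W, h) \<in> sx_class X (U \<inter> V) (\<lambda>x. F (f x) (g x))"
    then have "(W, h) \<in> sx_reps X" "\<forall>x\<in>W \<inter> U \<inter> V. h x = F (f x) (g x)"
      by (auto simp: sx_class_def)
    then show "(W, h) \<in> sx_lift2 X F (sx_class X U f) (sx_class X V g)"
      using sx_class_self[OF f] sx_class_self[OF g] unfolding sx_lift2_def by blast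
  qed
qed

section \<open>Operations and order of S(X) on representatives\<close>

context
  fixes X :: "'x topology" and U :: "'x set" and f :: "'x \<Rightarrow> real"
  assumes f: "(U, f) \<in> sx_reps X"
begin

lemma sx_reps_scale: "(U, \<lambda>x. c * f x) \<in> sx_reps X"
  by (rule sx_reps_comp1[OF f]) (intro continuous_intros)

lemma sx_reps_abs: "(U, \<lambda>x. \<bar>f x\<bar>) \<in> sx_reps X"
  by (rule sx_reps_comp1[OF f]) (intro continuous_intros)

lemma sx_scale_class:
  "sx_scale X c (sx_class X U f) = sx_class X U (\<lambda>x. c * f x)"
  unfolding sx_scale_def
  by (rule sx_lift1_class[OF f]) (intro continuous_intros)

lemma sx_abs_class:
  "sx_abs X (sx_class X U f) = sx_class X U (\<lambda>x. \<bar>f x\<bar>)"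
  unfolding sx_abs_def
  by (rule sx_lift1_class[OF f]) (intro continuous_intros)

end

context
  fixes X :: "'x topology" and U V :: "'x set" and f g :: "'x \<Rightarrow> real"
  assumes f: "(U, f) \<in> sx_reps X" and g: "(V, g) \<in> sx_reps X"
begin

lemma sx_reps_add: "(U \<inter> V, \<lambda>x. f x + g x) \<in> sx_reps X"
  by (rule sx_reps_comp2[OF f g]) (unfold case_prod_beta, intro continuous_intros)

lemma sx_reps_diff: "(U \<inter> V, \<lambda>x. f x - g x) \<in> sx_reps X"
  by (rule sx_reps_comp2[OF f g]) (unfold case_prod_beta, intro continuous_intros)

lemma sx_reps_max: "(U \<inter> V, \<lambda>x. max (f x) (g x)) \<in> sx_reps X"
  by (rule sx_reps_comp2[OF f g]) (unfold case_prod_beta, intro continuous_intros)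

lemma sx_reps_min: "(U \<inter> V, \<lambda>x. min (f x) (g x)) \<in> sx_reps X"
  by (rule sx_reps_comp2[OF f g]) (unfold case_prod_beta, intro continuous_intros)

lemma sx_add_class:
  "sx_add X (sx_class X U f) (sx_class X V g) = sx_class X (U \<inter> V) (\<lambda>x. f x + g x)"
  unfolding sx_add_def
  by (rule sx_lift2_class[OF f g]) (unfold case_prod_beta, intro continuous_intros)

lemma sx_diff_class:
  "sx_diff X (sx_class X U f) (sx_class X V g) = sx_class X (U \<inter> V) (\<lambda>x. f x - g x)"
  unfolding sx_diff_def
  by (rule sx_lift2_class[OF f g]) (unfold case_prod_beta, intro continuous_intros)

lemma sx_sup_class:
  "sx_sup X (sx_class X U f) (sx_class X V g) = sx_class X (U \<inter> V) (\<lambda>x. max (f x) (g x))"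
  unfolding sx_sup_def
  by (rule sx_lift2_class[OF f g]) (unfold case_prod_beta, intro continuous_intros)

lemma sx_inf_class:
  "sx_inf X (sx_class X U f) (sx_class X V g) = sx_class X (U \<inter> V) (\<lambda>x. min (f x) (g x))"
  unfolding sx_inf_def
  by (rule sx_lift2_class[OF f g]) (unfold case_prod_beta, intro continuous_intros)

lemma sx_le_classI:
  assumes D: "X closure_of D = topspace X" and le: "\<And>x. x \<in> U \<inter> V \<inter> D \<Longrightarrow> f x \<le> g x"
  shows "sx_le X (sx_class X U f) (sx_class X V g)"
  unfolding sx_le_def
proof (clarify)
  fix U' f' V' g' x
  assume f': "(U', f') \<in> sx_class X U f" and g': "(V', g') \<in> sx_class X V g" and x: "x \<in> U'" "x \<in> V'"
  have r: "(U', f') \<in> sx_reps X" "(V', g') \<in> sx_reps X" using f' g' by (auto simp: sx_class_def)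
  have fg: "f x \<le> g x" if "x \<in> U \<inter> V" for x by (rule sx_reps_le_on_dense[OF f g D le that])
  have UV: "X closure_of (U \<inter> V) = topspace X"
    by (rule dense_open_Int(2)[OF sx_repsD(1,2)[OF f] sx_repsD(1,2)[OF g]])
  show "f' x \<le> g' x"
    by (rule sx_reps_le_on_dense[OF r UV]) (use f' g' fg x in \<open>auto simp: sx_class_def\<close>)
qed

lemma sx_le_classD:
  assumes "sx_le X (sx_class X U f) (sx_class X V g)" "x \<in> U \<inter> V"
  shows "f x \<le> g x"
  using sx_class_self[OF f] sx_class_self[OF g] assms unfolding sx_le_def by blast

end

lemma sx_le_refl:
  assumes "a \<in> SX X" shows "sx_le X a a"
  using assms unfolding SX_iff by (auto intro: sx_le_classI[where D = "topspace X"])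

lemma sx_reps_zero: "(topspace X, \<lambda>x. 0) \<in> sx_reps X"
  by (simp add: sx_reps_def)

lemma sx_zero_class: "sx_zero X = sx_class X (topspace X) (\<lambda>x. 0)"
  by (auto simp: sx_zero_def sx_const_def sx_class_def sx_reps_def dest: openin_subset)

section \<open>Ultrafilters of positive elements\<close>

text \<open>The last clause expresses maximality: whatever is outside \<open>F\<close> is disjoint
  from a member of \<open>F\<close>. Upward closure is a consequence, see
  \<open>lattice_ultrafilter_mono\<close>. The complement corresponds to a minimal prime ideal of
  \<open>E\<close>.\<close>

definition lattice_ultrafilter :: "'a::{ordered_real_vector,lattice} set \<Rightarrow> bool" where
  "lattice_ultrafilter F \<longleftrightarrow> F \<noteq> {} \<and> (\<forall>u\<in>F. 0 < u) \<and> (\<forall>u\<in>F. \<forall>v\<in>F. inf u v \<in> F) \<and>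
     (\<forall>u\<ge>0. u \<notin> F \<longrightarrow> (\<exists>v\<in>F. inf u v = 0))"

lemma lattice_ultrafilterD:
  assumes "lattice_ultrafilter F"
  shows "u \<in> F \<Longrightarrow> 0 < u" "u \<in> F \<Longrightarrow> 0 \<le> u" "u \<in> F \<Longrightarrow> v \<in> F \<Longrightarrow> inf u v \<in> F"
    "0 \<le> u \<Longrightarrow> u \<notin> F \<Longrightarrow> \<exists>v\<in>F. inf u v = 0"
proof -
  show pos: "0 < u" if "u \<in> F" using assms that by (auto simp: lattice_ultrafilter_def)
  show "0 \<le> u" if "u \<in> F" using pos[OF that] by simp
  show "inf u v \<in> F" if "u \<in> F" "v \<in> F" using assms that unfolding lattice_ultrafilter_def by blast
  show "\<exists>v\<in>F. inf u v = 0" if "0 \<le> u" "u \<notin> F" using assms that unfolding lattice_ultrafilter_def by blast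
qed

text \<open>If \<open>v\<close> were outside \<open>F\<close>, some member \<open>w\<close> would be
  disjoint from it and hence from \<open>u\<close>, although \<open>inf u w\<close> is a member
  too.\<close>

lemma lattice_ultrafilter_mono:
  assumes F: "lattice_ultrafilter F" and "u \<in> F" "u \<le> v"
  shows "v \<in> F"
proof (rule ccontr)
  assume "v \<notin> F"
  moreover have "0 \<le> v"
    using assms by (auto simp: lattice_ultrafilter_def intro: order_trans less_imp_le)
  ultimately obtain w where "w \<in> F" "inf v w = 0"
    using lattice_ultrafilterD(4)[OF F] by blast
  then have "0 < inf u w" "inf u w \<le> 0"
    using F \<open>u \<in> F\<close> \<open>u \<le> v\<close> inf_mono[of u v w w] by (auto simp: lattice_ultrafilter_def)
  then show False by (simp add: less_le_not_le)
qed

text \<open>Zorn for sets of strictly positive elements that contain \<open>u\<close> and are closed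
  under meets. If \<open>w\<close> is disjoint from no member of a maximal such set
  \<open>M\<close>, then the filter \<open>G\<close> generated by \<open>M\<close> and
  \<open>w\<close> is again admissible, so \<open>w\<close> was already in \<open>M\<close>.\<close>

lemma lattice_ultrafilter_exists:
  fixes u :: "'a::{ordered_real_vector,lattice}"
  assumes "0 < u"
  shows "\<exists>F. lattice_ultrafilter F \<and> u \<in> F"
proof -
  define \<A> where "\<A> = {F. u \<in> F \<and> (\<forall>v\<in>F. 0 < v) \<and> (\<forall>v\<in>F. \<forall>w\<in>F. inf v w \<in> F)}"
  have "\<exists>M\<in>\<A>. \<forall>F\<in>\<A>. M \<subseteq> F \<longrightarrow> F = M"
  proof (rule subset_Zorn_nonempty)
    have "{u} \<in> \<A>" using assms by (auto simp: \<A>_def)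
    then show "\<A> \<noteq> {}" by blast
    fix C assume "C \<noteq> {}" and chain: "subset.chain \<A> C"
    then have C: "C \<subseteq> \<A>" and total: "\<And>F G. F \<in> C \<Longrightarrow> G \<in> C \<Longrightarrow> F \<subseteq> G \<or> G \<subseteq> F"
      by (auto simp: subset.chain_def)
    have "inf v w \<in> \<Union>C" if "v \<in> \<Union>C" "w \<in> \<Union>C" for v w
    proof -
      obtain F G where FG: "F \<in> C" "G \<in> C" "v \<in> F" "w \<in> G" using \<open>v \<in> \<Union>C\<close> \<open>w \<in> \<Union>C\<close> by blast
      from total[OF FG(1,2)] show ?thesis
      proof
        assume "F \<subseteq> G"
        then have "inf v w \<in> G" using FG C unfolding \<A>_def by blast
        then show ?thesis using FG by blast
      next
        assume "G \<subseteq> F"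
        then have "inf v w \<in> F" using FG C unfolding \<A>_def by blast
        then show ?thesis using FG by blast
      qed
    qed
    moreover have "u \<in> \<Union>C" "\<forall>v\<in>\<Union>C. 0 < v"
      using C \<open>C \<noteq> {}\<close> by (auto simp: \<A>_def)
    ultimately show "\<Union>C \<in> \<A>" unfolding \<A>_def by blast
  qed
  then obtain M where M: "M \<in> \<A>" and max: "\<And>F. F \<in> \<A> \<Longrightarrow> M \<subseteq> F \<Longrightarrow> F = M" by blast
  have uM: "u \<in> M" and posM: "\<And>v. v \<in> M \<Longrightarrow> 0 < v"
    and infM: "\<And>v w. v \<in> M \<Longrightarrow> w \<in> M \<Longrightarrow> inf v w \<in> M"
    using M by (auto simp: \<A>_def)
  have "\<exists>v\<in>M. inf w v = 0" if w: "0 \<le> w" "w \<notin> M" for w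
  proof (rule ccontr)
    assume no: "\<not> (\<exists>v\<in>M. inf w v = 0)"
    define G where "G = {x. \<exists>v\<in>M. inf w v \<le> x}"
    have pos: "0 < inf w v" if "v \<in> M" for v
      using no that w posM[OF that] by (auto simp: order.strict_iff_order)
    have "inf x y \<in> G" if xy: "x \<in> G" "y \<in> G" for x y
    proof -
      obtain v1 v2 where v: "v1 \<in> M" "v2 \<in> M" "inf w v1 \<le> x" "inf w v2 \<le> y"
        using xy by (auto simp: G_def)
      have "inf w (inf v1 v2) \<le> inf w v1" "inf w (inf v1 v2) \<le> inf w v2"
        by (auto intro: le_infI2)
      then have "inf w (inf v1 v2) \<le> inf x y"
        using v by (meson inf_greatest order_trans)
      then show ?thesis using infM v unfolding G_def by blast
    qed
    moreover have "M \<subseteq> G" unfolding G_def using inf_le2 by blast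
    moreover have "\<forall>x\<in>G. 0 < x"
      unfolding G_def using pos by (auto intro: less_le_trans)
    ultimately have "G \<in> \<A>" using uM by (auto simp: \<A>_def)
    then have "G = M" using \<open>M \<subseteq> G\<close> max by blast
    moreover have "w \<in> G" using uM unfolding G_def by (auto intro: bexI[of _ u])
    ultimately show False using w by blast
  qed
  then have "lattice_ultrafilter M"
    unfolding lattice_ultrafilter_def using uM posM infM by (intro conjI ballI allI impI) auto
  then show ?thesis using uM by blast
qed

text \<open>The points are the singletons of ultrafilters, purely to match the type \<open>'a set set\<close>.
  Writing \<open>P\<close> for the prime ideal complementary to the ultrafilter, \<open>positive_at p x\<close> says that
  the class of \<open>x\<close> is strictly positive in the totally ordered quotient by \<open>P\<close>.\<close>

definition ultra_points :: "'a::{ordered_real_vector,lattice} set set set" where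
  "ultra_points = {{F} | F. lattice_ultrafilter F}"

definition positive_at :: "'a::{ordered_real_vector,lattice} set set \<Rightarrow> 'a \<Rightarrow> bool" where
  "positive_at p x \<longleftrightarrow> sup x 0 \<in> \<Union>p"

lemma positive_at_exists:
  assumes "\<not> x \<le> 0"
  shows "\<exists>p\<in>ultra_points. positive_at p x"
proof -
  have "0 < sup x 0"
    using assms by (metis le_iff_sup less_le sup_ge2)
  then obtain F where "lattice_ultrafilter F" "sup x 0 \<in> F"
    using lattice_ultrafilter_exists by blast
  then show ?thesis by (auto simp: ultra_points_def positive_at_def)
qed

context
  fixes p :: "'a::{ordered_real_vector,lattice} set set"
  assumes p: "p \<in> ultra_points"
begin

lemma positive_at_mono:
  assumes "positive_at p x" "x \<le> y"
  shows "positive_at p y"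
proof -
  have "sup x 0 \<le> sup y 0" using assms(2) by (rule sup_mono) simp
  then show ?thesis
    using p assms(1) unfolding positive_at_def ultra_points_def
    by (auto intro: lattice_ultrafilter_mono simp del: le_sup_iff sup.bounded_iff)
qed

lemma positive_at_not_le:
  assumes "positive_at p x"
  shows "\<not> x \<le> 0"
proof
  assume "x \<le> 0"
  then have "0 \<in> \<Union>p" using assms by (simp add: positive_at_def sup_absorb2)
  then show False using p by (auto simp: ultra_points_def dest: lattice_ultrafilterD(1))
qed

lemma positive_at_pos_part: "positive_at p (sup x 0) \<longleftrightarrow> positive_at p x"
  by (simp add: positive_at_def sup_assoc)

lemma positive_at_inf: "positive_at p (inf x y) \<longleftrightarrow> positive_at p x \<and> positive_at p y"
proof
  assume "positive_at p x \<and> positive_at p y"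
  then have "positive_at p (inf (sup x 0) (sup y 0))"
    using p by (auto simp: positive_at_def ultra_points_def lattice_ultrafilter_def sup_absorb1)
  then have "positive_at p (sup (inf x y) 0)"
    by (rule positive_at_mono[OF _ lgroup_inf_pos_part_le])
  then show "positive_at p (inf x y)" by (simp only: positive_at_pos_part)
qed (metis inf_le1 inf_le2 positive_at_mono)

lemma positive_at_scaleR:
  assumes "0 < c" shows "positive_at p (c *\<^sub>R x) \<longleftrightarrow> positive_at p x"
proof -
  have *: "positive_at p (c *\<^sub>R x)" if c: "0 < c" and x: "positive_at p x" for c x
  proof (rule ccontr)
    assume n: "\<not> positive_at p (c *\<^sub>R x)"
    obtain F where F: "p = {F}" "lattice_ultrafilter F" using p by (auto simp: ultra_points_def)
    have cx: "sup (c *\<^sub>R x) 0 = c *\<^sub>R sup x 0" using c by (rule scaleR_pos_part)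
    have xF: "sup x 0 \<in> F" "c *\<^sub>R sup x 0 \<notin> F"
      using n x cx by (auto simp: positive_at_def F(1))
    then obtain v where v: "v \<in> F" "inf (c *\<^sub>R sup x 0) v = 0"
      using F(2) cx by (metis lattice_ultrafilter_def sup_ge2)
    define w where "w = inf (sup x 0) v"
    have "w \<in> F" "0 < w" using v(1) xF(1) F(2) by (auto simp: w_def lattice_ultrafilter_def)
    \<comment> \<open>With \<open>d \<le> c\<close> and \<open>d \<le> 1\<close>, the element
      \<open>d *\<^sub>R w\<close> lies below both \<open>c *\<^sub>R sup x 0\<close> and
      \<open>v\<close>, which are disjoint.\<close>
    define d where "d = min c 1"
    have d: "0 < d" "d \<le> c" "d \<le> 1" using c by (auto simp: d_def)
    have "w \<le> sup x 0" "w \<le> v" by (simp_all add: w_def)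
    have "d *\<^sub>R w \<le> c *\<^sub>R sup x 0"
      using d \<open>0 < w\<close> \<open>w \<le> sup x 0\<close> by (intro scaleR_mono) auto
    moreover have "d *\<^sub>R w \<le> 1 *\<^sub>R v"
      using d \<open>0 < w\<close> \<open>w \<le> v\<close> lattice_ultrafilterD(2)[OF F(2) v(1)]
      by (intro scaleR_mono) auto
    ultimately have "d *\<^sub>R w \<le> 0" using v(2) by (metis inf_greatest scaleR_one)
    then have "(1/d) *\<^sub>R (d *\<^sub>R w) \<le> (1/d) *\<^sub>R 0"
      using d(1) by (intro scaleR_left_mono) auto
    then show False using \<open>0 < w\<close> d by (simp add: less_le_not_le)
  qed
  show ?thesis
    using *[OF assms, of x] *[of "1/c" "c *\<^sub>R x"] assms by auto
qed

lemma positive_at_add: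
  assumes "positive_at p x" "positive_at p y"
  shows "positive_at p (x + y)"
proof -
  have "2 *\<^sub>R inf x y = inf x y + inf x y" by (simp add: scaleR_2)
  also have "\<dots> \<le> x + y" by (intro add_mono) auto
  finally have "2 *\<^sub>R inf x y \<le> x + y" .
  moreover have "positive_at p (2 *\<^sub>R inf x y)"
    using assms by (simp add: positive_at_scaleR positive_at_inf)
  ultimately show ?thesis using positive_at_mono by blast
qed

text \<open>Members of the ultrafilter disjoint from \<open>sup x 0\<close> and from
  \<open>sup y 0\<close> have a meet that is disjoint from the sum, by
  \<open>lgroup_inf_add_le\<close>. This is the totality of the order at \<open>p\<close>: applied
  to \<open>(x - s *\<^sub>R e) + (t *\<^sub>R e - x)\<close> it lets cuts be decided.\<close>

lemma positive_at_addD: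
  assumes "positive_at p (x + y)"
  shows "positive_at p x \<or> positive_at p y"
proof (rule ccontr)
  assume "\<not> ?thesis"
  obtain F where F: "p = {F}" "lattice_ultrafilter F" using p by (auto simp: ultra_points_def)
  with \<open>\<not> ?thesis\<close> have "sup x 0 \<notin> F" "sup y 0 \<notin> F" by (auto simp: positive_at_def)
  then obtain v w where vw: "v \<in> F" "w \<in> F" "inf (sup x 0) v = 0" "inf (sup y 0) w = 0"
    using lattice_ultrafilterD(4)[OF F(2)] sup_ge2 by metis
  define u where "u = inf v w"
  have u: "u \<in> F" "0 \<le> u" using vw F(2) by (auto simp: u_def lattice_ultrafilter_def less_imp_le)
  have "inf u (sup x 0 + sup y 0) \<le> inf u (sup x 0) + inf u (sup y 0)"
    using u by (intro lgroup_inf_add_le) auto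
  also have "\<dots> \<le> inf v (sup x 0) + inf w (sup y 0)"
    by (intro add_mono inf_mono) (auto simp: u_def)
  also have "\<dots> = 0" using vw by (simp add: inf.commute)
  finally have "inf u (sup x 0 + sup y 0) \<le> 0" .
  moreover have "sup (x + y) 0 \<le> sup x 0 + sup y 0"
    by (intro sup_least add_mono add_nonneg_nonneg) auto
  then have "inf u (sup (x + y) 0) \<le> inf u (sup x 0 + sup y 0)" by (rule inf_mono[OF order_refl])
  ultimately have "inf u (sup (x + y) 0) \<le> 0" by (rule order_trans[rotated])
  moreover have "0 < inf u (sup (x + y) 0)"
    using u F assms by (auto simp: positive_at_def lattice_ultrafilter_def)
  ultimately show False by (simp add: less_le_not_le)
qed

end

text \<open>An element of just one of the two ultrafilters is disjoint from some member of the
  other, and disjoint elements are never positive at a common point.\<close>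

lemma ultra_points_separated:
  assumes "p \<in> ultra_points" "q \<in> ultra_points" "p \<noteq> q"
  shows "\<exists>u v. positive_at p u \<and> positive_at q v \<and>
           (\<forall>r\<in>ultra_points. \<not> (positive_at r u \<and> positive_at r v))"
proof -
  have *: "\<exists>u v. positive_at p u \<and> positive_at q v \<and> inf u v = 0"
    if F: "p = {F}" "lattice_ultrafilter F" and G: "q = {G}" "lattice_ultrafilter G"
      and u: "u \<in> F" "u \<notin> G" for p q :: "'a set set" and F G u
  proof -
    have "0 \<le> u" using u F by (auto simp: lattice_ultrafilter_def less_imp_le)
    then obtain v where v: "v \<in> G" "inf u v = 0" using u lattice_ultrafilterD(4)[OF G(2)] by blast
    then have "0 \<le> v" using G by (auto simp: lattice_ultrafilter_def less_imp_le)
    then have "positive_at p u" "positive_at q v"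
      using F(1) G(1) u v \<open>0 \<le> u\<close> by (auto simp: positive_at_def sup_absorb1)
    then show ?thesis using v by blast
  qed
  obtain F G where FG: "p = {F}" "lattice_ultrafilter F" "q = {G}" "lattice_ultrafilter G"
    using assms by (auto simp: ultra_points_def)
  then consider u where "u \<in> F" "u \<notin> G" | u where "u \<in> G" "u \<notin> F"
    using \<open>p \<noteq> q\<close> by blast
  then obtain u v where uv: "positive_at p u" "positive_at q v" "inf u v = 0"
  proof cases
    case 1 then show ?thesis using *[OF FG] that by blast
  next
    case 2 then show ?thesis using *[OF FG(3,4) FG(1,2)] that by (metis inf.commute)
  qed
  have "\<not> (positive_at r u \<and> positive_at r v)" if "r \<in> ultra_points" for r
    using positive_at_inf[OF that, of u v] positive_at_not_le[OF that, of 0] uv(3) by auto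
  then show ?thesis using uv by blast
qed

section \<open>The topology on the set of ultrafilters\<close>

definition basic_open :: "'a::{ordered_real_vector,lattice} \<Rightarrow> 'a set set set" where
  "basic_open u = {p \<in> ultra_points. positive_at p u}"

definition ultra_topology :: "'a::{ordered_real_vector,lattice} set set topology" where
  "ultra_topology = topology (\<lambda>U. U \<subseteq> ultra_points \<and>
     (\<forall>p\<in>U. \<exists>u. p \<in> basic_open u \<and> basic_open u \<subseteq> U))"

lemma basic_open_inf: "basic_open (inf u v) = basic_open u \<inter> basic_open v"
  unfolding basic_open_def using positive_at_inf by blast

lemma openin_ultra_topology:
  "openin ultra_topology U \<longleftrightarrow> U \<subseteq> ultra_points \<and>
     (\<forall>p\<in>U. \<exists>u. p \<in> basic_open u \<and> basic_open u \<subseteq> U)"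
proof -
  have "istopology (\<lambda>U::'a set set set. U \<subseteq> ultra_points \<and>
     (\<forall>p\<in>U. \<exists>u. p \<in> basic_open u \<and> basic_open u \<subseteq> U))"
    unfolding istopology_def
  proof (intro conjI allI impI)
    fix S T :: "'a set set set"
    assume S: "S \<subseteq> ultra_points \<and> (\<forall>p\<in>S. \<exists>u. p \<in> basic_open u \<and> basic_open u \<subseteq> S)"
      and T: "T \<subseteq> ultra_points \<and> (\<forall>p\<in>T. \<exists>u. p \<in> basic_open u \<and> basic_open u \<subseteq> T)"
    show "S \<inter> T \<subseteq> ultra_points" using S by blast
    show "\<forall>p\<in>S \<inter> T. \<exists>u. p \<in> basic_open u \<and> basic_open u \<subseteq> S \<inter> T"
    proof
      fix p assume "p \<in> S \<inter> T"
      with S T obtain u v where "p \<in> basic_open u" "basic_open u \<subseteq> S" "p \<in> basic_open v" "basic_open v \<subseteq> T"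
        by blast
      then have "p \<in> basic_open (inf u v) \<and> basic_open (inf u v) \<subseteq> S \<inter> T"
        by (auto simp: basic_open_inf)
      then show "\<exists>u. p \<in> basic_open u \<and> basic_open u \<subseteq> S \<inter> T" by blast
    qed
  next
    fix K :: "'a set set set set"
    assume K: "\<forall>S\<in>K. S \<subseteq> ultra_points \<and> (\<forall>p\<in>S. \<exists>u. p \<in> basic_open u \<and> basic_open u \<subseteq> S)"
    show "\<Union>K \<subseteq> ultra_points" using K by blast
    show "\<forall>p\<in>\<Union>K. \<exists>u. p \<in> basic_open u \<and> basic_open u \<subseteq> \<Union>K"
      using K by (meson Sup_upper UnionE order_trans)
  qed
  then show ?thesis by (simp add: ultra_topology_def topology_inverse')
qed

lemma openin_basic_open: "openin ultra_topology (basic_open u)"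
  unfolding openin_ultra_topology using basic_open_def by blast

lemma topspace_ultra_topology: "topspace ultra_topology = ultra_points"
proof (rule subset_antisym)
  show "topspace ultra_topology \<subseteq> ultra_points"
    using openin_topspace[of ultra_topology] unfolding openin_ultra_topology by blast
  have "\<exists>u. p \<in> basic_open u \<and> basic_open u \<subseteq> ultra_points" if p: "p \<in> ultra_points"
    for p :: "'a set set"
  proof -
    obtain F where F: "p = {F}" "lattice_ultrafilter F" using p by (auto simp: ultra_points_def)
    then obtain u where "u \<in> F" by (auto simp: lattice_ultrafilter_def)
    then have "p \<in> basic_open u"
      using F(1) p lattice_ultrafilterD(2)[OF F(2)]
      by (auto simp: basic_open_def positive_at_def sup_absorb1)
    then show ?thesis by (auto simp: basic_open_def)
  qed
  then have "openin ultra_topology (ultra_points :: 'a set set set)"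
    unfolding openin_ultra_topology by blast
  then show "ultra_points \<subseteq> topspace (ultra_topology :: 'a set set topology)" by (rule openin_subset)
qed

lemma Hausdorff_ultra_topology: "Hausdorff_space ultra_topology"
  unfolding Hausdorff_space_def topspace_ultra_topology
proof (intro allI impI)
  fix p q :: "'a set set"
  assume pq: "p \<in> ultra_points \<and> q \<in> ultra_points \<and> p \<noteq> q"
  then obtain u v where "positive_at p u" "positive_at q v"
    "\<forall>r\<in>ultra_points. \<not> (positive_at r u \<and> positive_at r v)"
    using ultra_points_separated by blast
  then have "p \<in> basic_open u" "q \<in> basic_open v" "disjnt (basic_open u) (basic_open v)"
    using pq by (auto simp: basic_open_def disjnt_def)
  then show "\<exists>U V. openin ultra_topology U \<and> openin ultra_topology V \<and> p \<in> U \<and> q \<in> V \<and> disjnt U V"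
    using openin_basic_open by blast
qed

text \<open>A nonempty basic open set is also the one of the strictly positive element
  \<open>sup u 0\<close>, so testing strictly positive elements suffices.\<close>

lemma ultra_topology_dense:
  assumes "\<And>u::'a::{ordered_real_vector,lattice}. 0 < u \<Longrightarrow> basic_open u \<inter> D \<noteq> {}"
  shows "ultra_topology closure_of D = topspace ultra_topology"
proof -
  have "\<exists>q\<in>D. q \<in> U" if "p \<in> U" "openin ultra_topology U" for p U
  proof -
    obtain u where u: "p \<in> basic_open u" "basic_open u \<subseteq> U"
      using \<open>p \<in> U\<close> \<open>openin ultra_topology U\<close> unfolding openin_ultra_topology by blast
    then have p: "p \<in> ultra_points" "positive_at p (sup u 0)"
      by (auto simp: basic_open_def positive_at_def sup_assoc)
    have "0 < sup u 0" using positive_at_not_le[OF p] by (metis less_le order_refl sup_ge2)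
    moreover have "basic_open (sup u 0) = basic_open u"
      by (auto simp: basic_open_def positive_at_def sup_assoc)
    ultimately show ?thesis using assms u by blast
  qed
  then show ?thesis by (auto simp: closure_of_def)
qed

section \<open>The representation\<close>

text \<open>Informally, \<open>r\<close> is the standard part of \<open>x / e\<close> at
  \<open>p\<close>. Nothing is said about \<open>s = r\<close> or \<open>t = r\<close>, because
  \<open>x - r *\<^sub>R e\<close> may be infinitesimal of either sign.\<close>

definition has_value :: "'a::{ordered_real_vector,lattice} set set \<Rightarrow> 'a \<Rightarrow> 'a \<Rightarrow> real \<Rightarrow> bool" where
  "has_value p e x r \<longleftrightarrow> (\<forall>s<r. positive_at p (x - s *\<^sub>R e)) \<and> (\<forall>t>r. positive_at p (t *\<^sub>R e - x))"

context
  fixes p :: "'a::{ordered_real_vector,lattice} set set" and e :: 'a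
  assumes p: "p \<in> ultra_points" and e: "0 \<le> e" "positive_at p e"
begin

lemma positive_at_scaleR_unit: "positive_at p (c *\<^sub>R e) \<longleftrightarrow> 0 < c"
proof
  assume pos: "positive_at p (c *\<^sub>R e)"
  show "0 < c"
  proof (rule ccontr)
    assume "\<not> 0 < c"
    then have "c *\<^sub>R e \<le> 0" using e(1) by (simp add: scaleR_nonpos_nonneg)
    then show False using positive_at_not_le[OF p pos] by blast
  qed
qed (simp add: positive_at_scaleR[OF p] e)

lemma positive_at_cut_less:
  assumes "positive_at p (x - s *\<^sub>R e)" "positive_at p (t *\<^sub>R e - x)"
  shows "s < t"
proof -
  have "positive_at p ((x - s *\<^sub>R e) + (t *\<^sub>R e - x))" by (rule positive_at_add[OF p assms])
  then have "positive_at p ((t - s) *\<^sub>R e)" by (simp add: algebra_simps)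
  then show ?thesis by (simp add: positive_at_scaleR_unit)
qed

lemma positive_at_cut_cases:
  assumes "s < t"
  shows "positive_at p (x - s *\<^sub>R e) \<or> positive_at p (t *\<^sub>R e - x)"
proof -
  have "positive_at p ((t - s) *\<^sub>R e)" using assms by (simp add: positive_at_scaleR_unit)
  then have "positive_at p ((x - s *\<^sub>R e) + (t *\<^sub>R e - x))" by (simp add: algebra_simps)
  then show ?thesis by (rule positive_at_addD[OF p])
qed

lemma has_value_ge:
  assumes "has_value p e x r" "positive_at p (x - s *\<^sub>R e)"
  shows "s \<le> r"
proof (rule dense_ge)
  fix t assume "r < t"
  then have "positive_at p (t *\<^sub>R e - x)" using assms(1) by (simp add: has_value_def)
  then show "s \<le> t" using positive_at_cut_less[OF assms(2)] by (simp add: less_imp_le)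
qed

lemma has_value_unique:
  assumes "has_value p e x r" "has_value p e x q"
  shows "r = q"
proof -
  have "r \<le> q" if "has_value p e x r" "has_value p e x q" for r q
    by (rule dense_le) (use that has_value_ge[OF that(2)] in \<open>auto simp: has_value_def\<close>)
  then show ?thesis using assms by (metis order_antisym)
qed

lemma has_value_exists:
  assumes lower: "positive_at p (x - a *\<^sub>R e)" and upper: "positive_at p (b *\<^sub>R e - x)"
  shows "\<exists>r. has_value p e x r"
proof -
  define S where "S = {s. positive_at p (x - s *\<^sub>R e)}"
  have "a \<in> S" using lower by (simp add: S_def)
  have bdd: "bdd_above S"
    using positive_at_cut_less[OF _ upper] by (auto simp: S_def intro!: bdd_aboveI[of _ b] less_imp_le)
  have "positive_at p (x - s *\<^sub>R e)" if "s < Sup S" for s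
  proof -
    obtain s' where s': "s' \<in> S" "s < s'"
      using less_cSup_iff[OF _ bdd, of s] \<open>s < Sup S\<close> \<open>a \<in> S\<close> by blast
    have "s *\<^sub>R e \<le> s' *\<^sub>R e" using s' e by (intro scaleR_right_mono) auto
    then have "x - s' *\<^sub>R e \<le> x - s *\<^sub>R e" by (rule diff_left_mono)
    then show ?thesis using s'(1) positive_at_mono[OF p] by (auto simp: S_def)
  qed
  moreover have "positive_at p (t *\<^sub>R e - x)" if "Sup S < t" for t
  proof -
    \<comment> \<open>\<open>positive_at_cut_cases\<close> compares two different numbers, hence the
      extra \<open>t'\<close> strictly between \<open>Sup S\<close> and \<open>t\<close>.\<close>
    obtain t' where "Sup S < t'" "t' < t" using dense[OF \<open>Sup S < t\<close>] by blast
    moreover have "t' \<notin> S" using cSup_upper[OF _ bdd, of t'] \<open>Sup S < t'\<close> by auto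
    ultimately show ?thesis using positive_at_cut_cases[of t' t x] by (auto simp: S_def)
  qed
  ultimately show ?thesis unfolding has_value_def by blast
qed

lemma has_value_zero: "has_value p e 0 0"
proof -
  have "positive_at p ((- s) *\<^sub>R e)" if "s < 0" for s
    using that by (simp add: positive_at_scaleR_unit del: scaleR_minus_left)
  then show ?thesis by (simp add: has_value_def positive_at_scaleR_unit)
qed

lemma has_value_add:
  assumes "has_value p e x r" "has_value p e y q"
  shows "has_value p e (x + y) (r + q)"
  unfolding has_value_def
proof (intro conjI allI impI)
  fix s assume "s < r + q"
  \<comment> \<open>The slack is split evenly, so that \<open>s\<close> becomes the sum of a number
    below \<open>r\<close> and a number below \<open>q\<close>.\<close>
  define d where "d = (r + q - s) / 2"
  have d: "r - d < r" "q - d < q" "s = (r - d) + (q - d)"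
    using \<open>s < r + q\<close> by (auto simp: d_def field_simps)
  have "positive_at p ((x - (r - d) *\<^sub>R e) + (y - (q - d) *\<^sub>R e))"
    using assms d by (intro positive_at_add[OF p]) (auto simp: has_value_def)
  moreover have "(x - (r - d) *\<^sub>R e) + (y - (q - d) *\<^sub>R e) = x + y - s *\<^sub>R e"
    unfolding d(3) scaleR_add_left by simp
  ultimately show "positive_at p (x + y - s *\<^sub>R e)" by simp
next
  fix t assume "t > r + q"
  define d where "d = (t - (r + q)) / 2"
  have d: "r + d > r" "q + d > q" "t = (r + d) + (q + d)"
    using \<open>t > r + q\<close> by (auto simp: d_def field_simps)
  have "positive_at p (((r + d) *\<^sub>R e - x) + ((q + d) *\<^sub>R e - y))"
    using assms d by (intro positive_at_add[OF p]) (auto simp: has_value_def)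
  moreover have "((r + d) *\<^sub>R e - x) + ((q + d) *\<^sub>R e - y) = t *\<^sub>R e - (x + y)"
    unfolding d(3) scaleR_add_left[of "r + d"] by simp
  ultimately show "positive_at p (t *\<^sub>R e - (x + y))" by simp
qed

lemma has_value_minus:
  assumes "has_value p e x r"
  shows "has_value p e (- x) (- r)"
  unfolding has_value_def
proof (intro conjI allI impI)
  fix s assume "s < - r"
  then have "positive_at p ((- s) *\<^sub>R e - x)"
    using assms unfolding has_value_def by (metis less_minus_iff)
  moreover have "(- s) *\<^sub>R e - x = - x - s *\<^sub>R e" by simp
  ultimately show "positive_at p (- x - s *\<^sub>R e)" by metis
next
  fix t assume "- r < t"
  then have "positive_at p (x - (- t) *\<^sub>R e)"
    using assms unfolding has_value_def by (metis minus_less_iff)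
  moreover have "x - (- t) *\<^sub>R e = t *\<^sub>R e - - x" by simp
  ultimately show "positive_at p (t *\<^sub>R e - - x)" by metis
qed

lemma has_value_scaleR:
  assumes "has_value p e x r"
  shows "has_value p e (c *\<^sub>R x) (c * r)"
proof -
  have pos: "has_value p e (c *\<^sub>R x) (c * r)" if "0 < c" for c
    unfolding has_value_def
  proof (intro conjI allI impI)
    fix s assume "s < c * r"
    then have "positive_at p (c *\<^sub>R (x - (s / c) *\<^sub>R e))"
      using assms that by (simp add: positive_at_scaleR[OF p] has_value_def pos_divide_less_eq mult.commute)
    then show "positive_at p (c *\<^sub>R x - s *\<^sub>R e)"
      using that by (simp add: scaleR_right_diff_distrib)
  next
    fix t assume "c * r < t"
    then have "positive_at p (c *\<^sub>R ((t / c) *\<^sub>R e - x))"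
      using assms that by (simp add: positive_at_scaleR[OF p] has_value_def pos_less_divide_eq mult.commute)
    then show "positive_at p (t *\<^sub>R e - c *\<^sub>R x)"
      using that by (simp add: scaleR_right_diff_distrib)
  qed
  consider "c = 0" | "0 < c" | "0 < - c" by linarith
  then show ?thesis
  proof cases
    case 1 then show ?thesis by (simp add: has_value_zero)
  next
    case 2 then show ?thesis by (rule pos)
  next
    case 3
    from has_value_minus[OF pos[OF this]] show ?thesis by simp
  qed
qed

lemma has_value_sup:
  assumes "has_value p e x r" "has_value p e y q"
  shows "has_value p e (sup x y) (max r q)"
  unfolding has_value_def
proof (intro conjI allI impI)
  fix s assume "s < max r q"
  then have "positive_at p (x - s *\<^sub>R e) \<or> positive_at p (y - s *\<^sub>R e)"
    using assms unfolding has_value_def by (metis max_def)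
  moreover have "x - s *\<^sub>R e \<le> sup x y - s *\<^sub>R e" "y - s *\<^sub>R e \<le> sup x y - s *\<^sub>R e"
    by (rule diff_right_mono; simp)+
  ultimately show "positive_at p (sup x y - s *\<^sub>R e)" using positive_at_mono[OF p] by blast
next
  fix t assume "max r q < t"
  then have "positive_at p (inf (t *\<^sub>R e - x) (t *\<^sub>R e - y))"
    using assms by (simp add: has_value_def positive_at_inf[OF p])
  moreover have "inf (t *\<^sub>R e - x) (t *\<^sub>R e - y) = t *\<^sub>R e - sup x y"
    unfolding lgroup.diff_sup_eq_inf lgroup.add_inf_distrib_left by simp
  ultimately show "positive_at p (t *\<^sub>R e - sup x y)" by simp
qed

lemma has_value_inf:
  assumes "has_value p e x r" "has_value p e y q"
  shows "has_value p e (inf x y) (min r q)"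
proof -
  have "has_value p e (- sup (- x) (- y)) (- max (- r) (- q))"
    by (intro has_value_minus has_value_sup assms)
  then show ?thesis
    unfolding lgroup.inf_eq_neg_sup[of x y] by (simp only: minus_max_eq_min minus_minus)
qed

end

text \<open>Disjointness allows at most one unit to be positive at a given point. Maximality makes
  the points where some unit is positive dense, since \<open>basic_open u\<close> contains the
  nonempty set \<open>basic_open (inf u e)\<close> for a suitable unit \<open>e\<close>.\<close>

locale unit_family =
  fixes A :: "'a::{ordered_real_vector,lattice} set"
  assumes arch: "archimedean TYPE('a)"
    and unit_pos: "e \<in> A \<Longrightarrow> 0 < e"
    and unit_disjoint: "e \<in> A \<Longrightarrow> e' \<in> A \<Longrightarrow> e \<noteq> e' \<Longrightarrow> inf e e' = 0"
    and unit_maximal: "0 < u \<Longrightarrow> \<exists>e\<in>A. 0 < inf u e"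

text \<open>Zorn for disjoint families: a positive element disjoint from all members of a maximal
  family could be added to it.\<close>

lemma unit_family_exists:
  assumes arch: "archimedean TYPE('a::{ordered_real_vector,lattice})"
  shows "\<exists>A::'a set. unit_family A"
proof -
  define \<A> where "\<A> = {A::'a set. (\<forall>e\<in>A. 0 < e) \<and> (\<forall>e\<in>A. \<forall>e'\<in>A. e \<noteq> e' \<longrightarrow> inf e e' = 0)}"
  have "\<exists>M\<in>\<A>. \<forall>B\<in>\<A>. M \<subseteq> B \<longrightarrow> B = M"
  proof (rule subset_Zorn_nonempty)
    have "{} \<in> \<A>" by (simp add: \<A>_def)
    then show "\<A> \<noteq> {}" by blast
    fix C assume "subset.chain \<A> C"
    then have C: "C \<subseteq> \<A>" and total: "\<And>F G. F \<in> C \<Longrightarrow> G \<in> C \<Longrightarrow> F \<subseteq> G \<or> G \<subseteq> F"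
      by (auto simp: subset.chain_def)
    have "inf e e' = 0" if ee: "e \<in> \<Union>C" "e' \<in> \<Union>C" "e \<noteq> e'" for e e'
    proof -
      obtain F G where "F \<in> C" "G \<in> C" "e \<in> F" "e' \<in> G" using ee by blast
      then obtain H where "H \<in> C" "e \<in> H" "e' \<in> H" using total by blast
      then show ?thesis using C ee(3) unfolding \<A>_def by blast
    qed
    moreover have "\<forall>e\<in>\<Union>C. 0 < e" using C by (auto simp: \<A>_def)
    ultimately show "\<Union>C \<in> \<A>" unfolding \<A>_def by simp
  qed
  then obtain M where M: "M \<in> \<A>" and max: "\<And>B. B \<in> \<A> \<Longrightarrow> M \<subseteq> B \<Longrightarrow> B = M" by blast
  have posM: "0 < e" if "e \<in> M" for e using M that by (auto simp: \<A>_def)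
  have disM: "inf e e' = 0" if "e \<in> M" "e' \<in> M" "e \<noteq> e'" for e e'
    using M that unfolding \<A>_def by blast
  have "\<exists>e\<in>M. 0 < inf u e" if "0 < u" for u
  proof (rule ccontr)
    assume no: "\<not> (\<exists>e\<in>M. 0 < inf u e)"
    have dis: "inf u e = 0" if "e \<in> M" for e
    proof -
      have "0 \<le> inf u e" using posM[OF that] \<open>0 < u\<close> by (simp add: less_imp_le)
      then show ?thesis using no that by (metis less_le)
    qed
    have "insert u M \<in> \<A>"
      unfolding \<A>_def mem_Collect_eq
    proof (intro conjI ballI impI)
      fix e assume "e \<in> insert u M"
      then show "0 < e" using posM \<open>0 < u\<close> by blast
      fix e' assume "e' \<in> insert u M" "e \<noteq> e'"
      then show "inf e e' = 0"
        using \<open>e \<in> insert u M\<close> dis disM by (metis inf.commute insertE)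
    qed
    then have "u \<in> M" using max by blast
    then have "inf u u = 0" by (rule dis)
    then show False using \<open>0 < u\<close> by simp
  qed
  then have "unit_family M" using arch posM disM by unfold_locales
  then show ?thesis by blast
qed

section \<open>From cuts at points to continuous functions\<close>

context unit_family
begin

definition value_dom :: "'a \<Rightarrow> 'a set set set" where
  "value_dom x = {p \<in> ultra_points. \<exists>e\<in>A. positive_at p e \<and> (\<exists>r. has_value p e x r)}"

definition value_at :: "'a \<Rightarrow> 'a set set \<Rightarrow> real" where
  "value_at x p = (THE r. \<exists>e\<in>A. positive_at p e \<and> has_value p e x r)"

lemma unit_unique:
  assumes p: "p \<in> ultra_points" and "e \<in> A" "e' \<in> A" "positive_at p e" "positive_at p e'"
  shows "e = e'"
proof (rule ccontr)
  assume "e \<noteq> e'"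
  then have "inf e e' = 0" using unit_disjoint assms by blast
  moreover have "positive_at p (inf e e')" using assms by (simp add: positive_at_inf[OF p])
  ultimately show False using positive_at_not_le[OF p] by auto
qed

lemma value_atI:
  assumes p: "p \<in> ultra_points" and e: "e \<in> A" "positive_at p e" and v: "has_value p e x r"
  shows "p \<in> value_dom x" "value_at x p = r"
proof -
  show "p \<in> value_dom x" using assms by (auto simp: value_dom_def)
  have uniq: "q = r" if "e' \<in> A" "positive_at p e'" "has_value p e' x q" for e' q
  proof -
    have "e' = e" using unit_unique[OF p] that e by blast
    then show ?thesis using has_value_unique[OF p _ e(2) _ v] that(3) unit_pos[OF e(1)] by simp
  qed
  show "value_at x p = r"
    unfolding value_at_def by (rule the_equality) (use uniq e v in blast)+
qed

lemma value_domE: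
  assumes "p \<in> value_dom x"
  obtains e where "p \<in> ultra_points" "e \<in> A" "0 \<le> e" "positive_at p e" "has_value p e x (value_at x p)"
proof -
  obtain e r where *: "p \<in> ultra_points" "e \<in> A" "positive_at p e" "has_value p e x r"
    using assms by (auto simp: value_dom_def)
  then show ?thesis using that[OF *(1,2)] value_atI(2)[OF *] unit_pos[OF *(2)] by simp
qed

lemma value_dom_common:
  assumes "p \<in> value_dom x" "p \<in> value_dom y"
  obtains e where "p \<in> ultra_points" "e \<in> A" "0 \<le> e" "positive_at p e"
    "has_value p e x (value_at x p)" "has_value p e y (value_at y p)"
proof -
  obtain e where e: "p \<in> ultra_points" "e \<in> A" "0 \<le> e" "positive_at p e" "has_value p e x (value_at x p)"
    using assms(1) by (rule value_domE)
  obtain e' where e': "e' \<in> A" "positive_at p e'" "has_value p e' y (value_at y p)"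
    using assms(2) by (rule value_domE)
  have "e' = e" using unit_unique e e' by blast
  then show ?thesis using that e e' by blast
qed

lemma value_add:
  assumes "p \<in> value_dom x" "p \<in> value_dom y"
  shows "p \<in> value_dom (x + y)" "value_at (x + y) p = value_at x p + value_at y p"
proof -
  obtain e where e: "p \<in> ultra_points" "e \<in> A" "0 \<le> e" "positive_at p e"
    and v: "has_value p e x (value_at x p)" "has_value p e y (value_at y p)"
    using assms by (rule value_dom_common)
  note * = value_atI[OF e(1,2,4) has_value_add[OF e(1,3,4) v]]
  show "p \<in> value_dom (x + y)" by (rule *)
  show "value_at (x + y) p = value_at x p + value_at y p" by (rule *)
qed

lemma value_scaleR:
  assumes "p \<in> value_dom x"
  shows "p \<in> value_dom (c *\<^sub>R x)" "value_at (c *\<^sub>R x) p = c * value_at x p"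
proof -
  obtain e where e: "p \<in> ultra_points" "e \<in> A" "0 \<le> e" "positive_at p e"
    and v: "has_value p e x (value_at x p)"
    using assms by (rule value_domE)
  note * = value_atI[OF e(1,2,4) has_value_scaleR[OF e(1,3,4) v]]
  show "p \<in> value_dom (c *\<^sub>R x)" by (rule *)
  show "value_at (c *\<^sub>R x) p = c * value_at x p" by (rule *)
qed

lemma value_sup:
  assumes "p \<in> value_dom x" "p \<in> value_dom y"
  shows "p \<in> value_dom (sup x y)" "value_at (sup x y) p = max (value_at x p) (value_at y p)"
proof -
  obtain e where e: "p \<in> ultra_points" "e \<in> A" "0 \<le> e" "positive_at p e"
    and v: "has_value p e x (value_at x p)" "has_value p e y (value_at y p)"
    using assms by (rule value_dom_common)
  note * = value_atI[OF e(1,2,4) has_value_sup[OF e(1,3,4) v]]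
  show "p \<in> value_dom (sup x y)" by (rule *)
  show "value_at (sup x y) p = max (value_at x p) (value_at y p)" by (rule *)
qed

lemma value_inf:
  assumes "p \<in> value_dom x" "p \<in> value_dom y"
  shows "p \<in> value_dom (inf x y)" "value_at (inf x y) p = min (value_at x p) (value_at y p)"
proof -
  obtain e where e: "p \<in> ultra_points" "e \<in> A" "0 \<le> e" "positive_at p e"
    and v: "has_value p e x (value_at x p)" "has_value p e y (value_at y p)"
    using assms by (rule value_dom_common)
  note * = value_atI[OF e(1,2,4) has_value_inf[OF e(1,3,4) v]]
  show "p \<in> value_dom (inf x y)" by (rule *)
  show "value_at (inf x y) p = min (value_at x p) (value_at y p)" by (rule *)
qed

lemma value_minus:
  assumes "p \<in> value_dom x"
  shows "p \<in> value_dom (- x)" "value_at (- x) p = - value_at x p"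
  using value_scaleR[OF assms, of "-1"] by simp_all

lemma value_dom_minus: "value_dom (- x) = value_dom x"
  using value_minus(1)[of _ x] value_minus(1)[of _ "- x", unfolded minus_minus] by blast

text \<open>Bounds by multiples of a unit on both sides exclude infinite values. Both openness and
  density of \<open>value_dom x\<close> are obtained by exhibiting such bounds.\<close>

lemma basic_open_subset_value_dom:
  assumes "e \<in> A"
  shows "basic_open (inf e (inf (x - a *\<^sub>R e) (b *\<^sub>R e - x))) \<subseteq> value_dom x"
proof
  fix p assume "p \<in> basic_open (inf e (inf (x - a *\<^sub>R e) (b *\<^sub>R e - x)))"
  then have p: "p \<in> ultra_points" "positive_at p e" "positive_at p (x - a *\<^sub>R e)" "positive_at p (b *\<^sub>R e - x)"
    by (auto simp: basic_open_def positive_at_inf)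
  then obtain r where "has_value p e x r"
    using has_value_exists[OF p(1) _ p(2) p(3,4)] less_imp_le[OF unit_pos[OF assms]] by blast
  then show "p \<in> value_dom x" using value_atI(1) p assms by blast
qed

lemma openin_value_dom: "openin ultra_topology (value_dom x)"
  unfolding openin_ultra_topology
proof (intro conjI ballI)
  show "value_dom x \<subseteq> ultra_points" by (auto simp: value_dom_def)
  fix p assume "p \<in> value_dom x"
  then obtain e where e: "p \<in> ultra_points" "e \<in> A" "positive_at p e" and v: "has_value p e x (value_at x p)"
    by (rule value_domE)
  let ?u = "inf e (inf (x - (value_at x p - 1) *\<^sub>R e) ((value_at x p + 1) *\<^sub>R e - x))"
  have "positive_at p (x - (value_at x p - 1) *\<^sub>R e)" "positive_at p ((value_at x p + 1) *\<^sub>R e - x)"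
    using v unfolding has_value_def by auto
  then have "p \<in> basic_open ?u"
    using e by (simp add: basic_open_def positive_at_inf)
  then show "\<exists>u. p \<in> basic_open u \<and> basic_open u \<subseteq> value_dom x"
    using basic_open_subset_value_dom[OF e(2)] by blast
qed

text \<open>Take \<open>w > 0\<close> below \<open>u\<close> and a unit \<open>e\<close>. By the
  Archimedean property some multiple \<open>real n *\<^sub>R w\<close> is not below the modulus
  \<open>z\<close> of \<open>x\<close>. At a point where \<open>real n *\<^sub>R w - z\<close> is
  positive, \<open>u\<close> and \<open>e\<close> are positive and \<open>x\<close> is bounded on
  both sides by multiples of \<open>e\<close>.\<close>

lemma value_dom_meets_basic_open:
  assumes "0 < u"
  shows "basic_open u \<inter> value_dom x \<noteq> {}"
proof -
  obtain e where e: "e \<in> A" "0 < inf u e" using unit_maximal[OF assms] by blast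
  define w where "w = inf u e"
  have w: "0 < w" "w \<le> u" "w \<le> e" using e by (auto simp: w_def)
  define z where "z = sup x (- x)"
  have z: "x \<le> z" "- x \<le> z" by (auto simp: z_def)
  have "\<exists>n. \<not> real n *\<^sub>R w \<le> z"
    using arch w(1) unfolding archimedean_def by (metis less_le_not_le)
  then obtain n where n: "\<not> real n *\<^sub>R w - z \<le> 0" by auto
  then have "\<exists>p\<in>ultra_points. positive_at p (real n *\<^sub>R w - z)" by (rule positive_at_exists)
  then obtain p where p: "p \<in> ultra_points" "positive_at p (real n *\<^sub>R w - z)" by blast
  have "0 \<le> z" using labs_nonneg[of x] by (simp add: labs_def z_def)
  then have "positive_at p (real n *\<^sub>R w)" using positive_at_mono[OF p] by simp
  moreover have "0 < real n" 
    using calculation positive_at_not_le[OF p(1), of 0] by (cases "n = 0") auto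
  ultimately have pw: "positive_at p w" using positive_at_scaleR[OF p(1)] by blast
  have pe: "positive_at p e" and pu: "positive_at p u" using pw w positive_at_mono[OF p(1)] by blast+
  have le: "real n *\<^sub>R w \<le> real n *\<^sub>R e" using w by (intro scaleR_left_mono) auto
  have "real n *\<^sub>R w - z \<le> real n *\<^sub>R e - x" by (intro diff_mono le z)
  then have up: "positive_at p (real n *\<^sub>R e - x)" by (rule positive_at_mono[OF p])
  have "real n *\<^sub>R w - z \<le> real n *\<^sub>R e - (- x)" by (intro diff_mono le z)
  also have "\<dots> = x - (- real n) *\<^sub>R e" by simp
  finally have lo: "positive_at p (x - (- real n) *\<^sub>R e)" by (rule positive_at_mono[OF p])
  have "p \<in> basic_open (inf e (inf (x - (- real n) *\<^sub>R e) (real n *\<^sub>R e - x)))"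
    unfolding basic_open_inf using p(1) pe lo up by (simp add: basic_open_def)
  then have "p \<in> value_dom x" using basic_open_subset_value_dom[OF e(1)] by blast
  then show ?thesis using p(1) pu by (auto simp: basic_open_def)
qed

lemma value_dom_dense: "ultra_topology closure_of value_dom x = topspace ultra_topology"
  by (rule ultra_topology_dense) (rule value_dom_meets_basic_open)

lemma openin_value_gt: "openin ultra_topology {p \<in> value_dom x. a < value_at x p}"
  unfolding openin_ultra_topology
proof (intro conjI ballI)
  show "{p \<in> value_dom x. a < value_at x p} \<subseteq> ultra_points" by (auto simp: value_dom_def)
  fix p assume "p \<in> {p \<in> value_dom x. a < value_at x p}"
  then have px: "p \<in> value_dom x" "a < value_at x p" by auto
  \<comment> \<open>Positivity of \<open>x - s *\<^sub>R e\<close> near \<open>p\<close> yields only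
    \<open>s \<le> value_at x q\<close>; strictness above \<open>a\<close> comes from taking
    \<open>s\<close> between.\<close>
  then obtain s where s: "a < s" "s < value_at x p" using dense by blast
  obtain e where e: "p \<in> ultra_points" "e \<in> A" "positive_at p e" and v: "has_value p e x (value_at x p)"
    using px(1) by (rule value_domE)
  obtain u where u: "p \<in> basic_open u" "basic_open u \<subseteq> value_dom x"
    using openin_value_dom px(1) unfolding openin_ultra_topology by blast
  let ?u = "inf u (inf e (x - s *\<^sub>R e))"
  have "positive_at p (x - s *\<^sub>R e)" using v s by (simp add: has_value_def)
  then have "p \<in> basic_open ?u" using e u by (simp add: basic_open_inf) (simp add: basic_open_def)
  moreover have "basic_open ?u \<subseteq> {p \<in> value_dom x. a < value_at x p}"
  proof
    fix q assume "q \<in> basic_open ?u"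
    then have q: "q \<in> value_dom x" "positive_at q e" "positive_at q (x - s *\<^sub>R e)"
      using u(2) by (auto simp: basic_open_inf) (auto simp: basic_open_def)
    obtain e' where e': "q \<in> ultra_points" "e' \<in> A" "0 \<le> e'" "positive_at q e'" "has_value q e' x (value_at x q)"
      using q(1) by (rule value_domE)
    have "e' = e" using unit_unique e' e q by blast
    then have "s \<le> value_at x q" using has_value_ge[OF e'(1,3,4,5)] q(3) by blast
    then show "q \<in> {p \<in> value_dom x. a < value_at x p}" using q s by auto
  qed
  ultimately show "\<exists>u. p \<in> basic_open u \<and> basic_open u \<subseteq> {p \<in> value_dom x. a < value_at x p}" by blast
qed

lemma value_reps: "(value_dom x, value_at x) \<in> sx_reps ultra_topology"
proof -
  have sub: "value_dom x \<subseteq> topspace ultra_topology" by (rule openin_subset[OF openin_value_dom])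
  have gt: "openin (subtopology ultra_topology (value_dom x)) {p \<in> value_dom x. a < value_at x p}" for a
    using openin_value_gt[of x a] by (auto simp: openin_open_subtopology openin_value_dom)
  have "{p \<in> value_dom x. value_at x p < a} = {p \<in> value_dom (- x). - a < value_at (- x) p}" for a
    by (auto simp: value_dom_minus value_minus)
  then have lt: "openin (subtopology ultra_topology (value_dom x)) {p \<in> value_dom x. value_at x p < a}" for a
    using openin_value_gt[of "- x" "- a"] by (auto simp: openin_open_subtopology openin_value_dom value_dom_minus)
  have "continuous_map (subtopology ultra_topology (value_dom x)) euclideanreal (value_at x)"
    using gt lt sub by (auto simp: continuous_map_upper_lower_semicontinuous_lt inf_absorb2)
  then show ?thesis
    using openin_value_dom value_dom_dense by (auto simp: sx_reps_def)
qed

definition represent :: "'a \<Rightarrow> 'a set set sx" where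
  "represent x = sx_class ultra_topology (value_dom x) (value_at x)"

lemma represent_add: "represent (x + y) = sx_add ultra_topology (represent x) (represent y)"
  unfolding represent_def sx_add_class[OF value_reps value_reps]
  by (rule sx_class_eqI[OF value_reps sx_reps_add[OF value_reps value_reps] closure_of_topspace])
    (auto simp: value_add)

lemma represent_scaleR: "represent (c *\<^sub>R x) = sx_scale ultra_topology c (represent x)"
  unfolding represent_def sx_scale_class[OF value_reps]
  by (rule sx_class_eqI[OF value_reps sx_reps_scale[OF value_reps] closure_of_topspace])
    (auto simp: value_scaleR)

lemma represent_sup: "represent (sup x y) = sx_sup ultra_topology (represent x) (represent y)"
  unfolding represent_def sx_sup_class[OF value_reps value_reps]
  by (rule sx_class_eqI[OF value_reps sx_reps_max[OF value_reps value_reps] closure_of_topspace])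
    (auto simp: value_sup)

lemma represent_inf: "represent (inf x y) = sx_inf ultra_topology (represent x) (represent y)"
  unfolding represent_def sx_inf_class[OF value_reps value_reps]
  by (rule sx_class_eqI[OF value_reps sx_reps_min[OF value_reps value_reps] closure_of_topspace])
    (auto simp: value_inf)

text \<open>A point where \<open>x - y\<close> is positive is not enough, as the difference may be
  infinitesimal there. Let \<open>w > 0\<close> lie below a unit \<open>e\<close> and below
  \<open>sup (x - y) 0\<close>. Since \<open>real n *\<^sub>R w \<le> e\<close> fails for some
  \<open>n\<close>, there is a point where \<open>w - d *\<^sub>R e\<close> is positive for
  \<open>d = 1 / real n\<close>, and it can be chosen in both domains. There the value of
  \<open>x\<close> exceeds that of \<open>y\<close> by at least \<open>d\<close>.\<close>

lemma represent_le_imp_le: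
  assumes le: "sx_le ultra_topology (represent x) (represent y)"
  shows "x \<le> y"
proof (rule ccontr)
  assume "\<not> x \<le> y"
  then have "\<not> x - y \<le> 0" by simp
  then have "0 < sup (x - y) 0" by (metis less_le order_refl sup_ge1 sup_ge2)
  then obtain e where e: "e \<in> A" "0 < inf (sup (x - y) 0) e" using unit_maximal by blast
  define w where "w = inf (sup (x - y) 0) e"
  have w: "0 < w" "w \<le> e" "w \<le> sup (x - y) 0" using e by (auto simp: w_def)
  have "\<exists>n. \<not> real n *\<^sub>R w \<le> e"
    using arch w(1) unfolding archimedean_def by (metis less_le_not_le)
  then obtain n where n: "\<not> real n *\<^sub>R w \<le> e" by blast
  have "0 < n" using n unit_pos[OF e(1)] by (cases n) auto
  define d where "d = 1 / real n"
  have d: "0 < d" using \<open>0 < n\<close> by (simp add: d_def)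
  have "\<not> w - d *\<^sub>R e \<le> 0"
  proof
    assume "w - d *\<^sub>R e \<le> 0"
    then have "real n *\<^sub>R w \<le> real n *\<^sub>R (d *\<^sub>R e)" by (intro scaleR_left_mono) auto
    then show False using n \<open>0 < n\<close> by (simp add: d_def)
  qed
  then have "0 < sup (w - d *\<^sub>R e) 0" by (metis less_le order_refl sup_ge1 sup_ge2)
  then have "basic_open (sup (w - d *\<^sub>R e) 0) \<inter> (value_dom x \<inter> value_dom y) \<noteq> {}"
  proof -
    let ?O = "basic_open (sup (w - d *\<^sub>R e) 0)"
    obtain q where q: "q \<in> ?O" "q \<in> value_dom x"
      using value_dom_meets_basic_open[OF \<open>0 < sup (w - d *\<^sub>R e) 0\<close>] by blast
    have "openin ultra_topology (?O \<inter> value_dom x)"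
      by (intro openin_Int openin_basic_open openin_value_dom)
    moreover have "q \<in> ultra_topology closure_of value_dom y"
      unfolding value_dom_dense using q openin_subset[OF openin_value_dom] by blast
    ultimately show ?thesis using q by (auto simp: in_closure_of)
  qed
  then obtain p where p: "p \<in> ultra_points" "positive_at p (w - d *\<^sub>R e)" "p \<in> value_dom x" "p \<in> value_dom y"
    by (auto simp: basic_open_def positive_at_pos_part)
  have "w - d *\<^sub>R e \<le> w" using d unit_pos[OF e(1)] by (simp add: scaleR_nonneg_nonneg)
  then have "positive_at p e" using w(2) positive_at_mono[OF p(1,2)] by (meson order_trans)
  obtain e' where e': "e' \<in> A" "0 \<le> e'" "positive_at p e'"
    "has_value p e' x (value_at x p)" "has_value p e' y (value_at y p)"
    using p(3,4) by (rule value_dom_common)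
  have "e' = e" using unit_unique[OF p(1)] e' e(1) \<open>positive_at p e\<close> by blast
  have "w - d *\<^sub>R e \<le> sup (x - y) 0 - d *\<^sub>R e" using w(3) by (rule diff_right_mono)
  also have "\<dots> \<le> sup (x - y - d *\<^sub>R e) 0"
  proof -
    have "0 \<le> d *\<^sub>R e" using d unit_pos[OF e(1)] by (simp add: scaleR_nonneg_nonneg)
    then have "sup (x - y) 0 \<le> sup (x - y) (d *\<^sub>R e)" by (rule sup_mono[OF order_refl])
    then have "sup (x - y) 0 \<le> sup (x - y - d *\<^sub>R e) 0 + d *\<^sub>R e"
      unfolding lgroup.add_sup_distrib_right by (simp only: diff_add_cancel add_0_left)
    then show ?thesis by (simp only: diff_le_eq)
  qed
  finally have "positive_at p (x - y - d *\<^sub>R e)"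
    using positive_at_mono[OF p(1,2)] positive_at_pos_part[OF p(1)] by blast
  moreover have "has_value p e (x + (- 1) *\<^sub>R y) (value_at x p + (- 1) * value_at y p)"
    using e' \<open>e' = e\<close> p(1) by (intro has_value_add has_value_scaleR) auto
  then have v: "has_value p e (x - y) (value_at x p - value_at y p)" by simp
  ultimately have "d \<le> value_at x p - value_at y p"
    using has_value_ge[OF p(1) _ _ v] e' \<open>e' = e\<close> by blast
  moreover have "value_at x p \<le> value_at y p"
    using sx_le_classD[OF value_reps value_reps le[unfolded represent_def]] p(3,4) by blast
  ultimately show False using d by simp
qed

lemma inj_represent: "inj represent"
proof (rule injI)
  fix x y assume eq: "represent x = represent y"
  have "sx_le ultra_topology (represent x) (represent x)"
    by (rule sx_le_refl) (simp add: represent_def value_reps)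
  then show "x = y" using represent_le_imp_le eq by (metis order_antisym)
qed

lemma represent_in_SX: "represent x \<in> SX ultra_topology"
  by (simp add: represent_def value_reps)

lemma represent_zero: "represent 0 = sx_zero ultra_topology"
proof -
  have "value_at 0 p = 0" if "p \<in> value_dom 0" for p
    using value_scaleR(2)[OF that, of 0] by simp
  then show ?thesis
    unfolding represent_def sx_zero_class
    by (intro sx_class_eqI[OF value_reps sx_reps_zero closure_of_topspace]) auto
qed

text \<open>A nonzero positive \<open>f\<close> exceeds some \<open>d > 0\<close> on a basic open
  set. An element \<open>u > 0\<close> that is positive only inside this set, and is cut down to lie
  below a unit, gives the element \<open>d *\<^sub>R u\<close> below \<open>f\<close>.\<close>

lemma represent_order_dense: "sx_order_dense ultra_topology (range represent)"
  unfolding sx_order_dense_def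
proof (intro ballI impI)
  fix a :: "'a set set sx"
  let ?X = "ultra_topology :: 'a set set topology"
  assume "a \<in> SX ?X" and lt: "sx_lt ?X (sx_zero ?X) a"
  then obtain U f where f: "(U, f) \<in> sx_reps ?X" and a: "a = sx_class ?X U f"
    unfolding SX_iff by blast
  have f0: "0 \<le> f p" if "p \<in> U" for p
    using sx_le_classD[OF sx_reps_zero f, of p] lt that openin_subset[OF sx_repsD(1)[OF f]]
    unfolding sx_lt_def a sx_zero_class by blast
  have "\<exists>p\<in>U. f p \<noteq> 0"
  proof (rule ccontr)
    assume "\<not> ?thesis"
    then have "sx_class ?X (topspace ?X) (\<lambda>x. 0) = sx_class ?X U f"
      by (intro sx_class_eqI[OF sx_reps_zero f closure_of_topspace]) auto
    then show False using lt unfolding sx_lt_def a sx_zero_class by blast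
  qed
  then obtain p0 where p0: "p0 \<in> U" "0 < f p0" using f0 by (metis less_le)
  define d where "d = f p0 / 2"
  have d: "0 < d" "d < f p0" using p0 by (auto simp: d_def)
  have "openin (subtopology ?X U) {p \<in> U. d < f p}"
    using sx_repsD(3)[OF f] openin_subset[OF sx_repsD(1)[OF f]]
    unfolding continuous_map_upper_lower_semicontinuous_lt by (auto simp: inf_absorb2)
  then have "openin ?X {p \<in> U. d < f p}"
    using sx_repsD(1)[OF f] by (simp add: openin_open_subtopology)
  moreover have "p0 \<in> {p \<in> U. d < f p}" using p0 d by simp
  ultimately obtain u0 where u0: "p0 \<in> basic_open u0" "basic_open u0 \<subseteq> {p \<in> U. d < f p}"
    unfolding openin_ultra_topology by blast
  have p0u: "p0 \<in> ultra_points" "positive_at p0 u0" using u0(1) by (auto simp: basic_open_def)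
  then have "0 < sup u0 0" using positive_at_not_le by (metis less_le order_refl sup_ge1 sup_ge2)
  then obtain e where e: "e \<in> A" "0 < inf (sup u0 0) e" using unit_maximal by blast
  define u where "u = inf (sup u0 0) e"
  have u: "0 < u" "u \<le> e" "u \<le> sup u0 0" using e by (auto simp: u_def)
  have Ku: "d < f p" if "p \<in> U" "positive_at p u" "p \<in> ultra_points" for p
  proof -
    have "positive_at p u0"
      using positive_at_mono[OF that(3,2) u(3)] positive_at_pos_part[OF that(3)] by blast
    then show ?thesis using u0(2) that by (auto simp: basic_open_def)
  qed
  \<comment> \<open>Where \<open>u\<close> is positive, \<open>u \<le> e\<close> keeps its value at
    most 1 while \<open>f\<close> exceeds \<open>d\<close>; elsewhere its value is at most 0 and
    \<open>f\<close> is nonnegative.\<close>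
  have le: "value_at (d *\<^sub>R u) p \<le> f p" if pU: "p \<in> U" and pu: "p \<in> value_dom u" for p
  proof -
    obtain e' where e': "p \<in> ultra_points" "e' \<in> A" "0 \<le> e'" "positive_at p e'" "has_value p e' u (value_at u p)"
      using pu by (rule value_domE)
    have v: "value_at (d *\<^sub>R u) p = d * value_at u p" using pu by (rule value_scaleR)
    show ?thesis
    proof (cases "positive_at p u")
      case True
      then have "positive_at p e" using u(2) positive_at_mono[OF e'(1)] by blast
      then have "e' = e" using unit_unique e' e by blast
      have "value_at u p \<le> 1"
      proof (rule ccontr)
        assume "\<not> value_at u p \<le> 1"
        then have "positive_at p (u - 1 *\<^sub>R e)" using e'(5) \<open>e' = e\<close> unfolding has_value_def by (metis not_le)
        then show False using positive_at_not_le[OF e'(1), of "u - 1 *\<^sub>R e"] u(2) by simp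
      qed
      then have "d * value_at u p \<le> d" using d by (simp add: mult_left_le)
      then show ?thesis using v Ku[OF pU True e'(1)] by linarith
    next
      case False
      have "value_at u p \<le> 0"
      proof (rule ccontr)
        assume "\<not> value_at u p \<le> 0"
        then have "positive_at p (u - 0 *\<^sub>R e')" using e'(5) unfolding has_value_def by (metis not_le)
        then show False using False by simp
      qed
      then have "d * value_at u p \<le> 0" using d by (simp add: mult_nonneg_nonpos)
      then show ?thesis using v f0[OF pU] by linarith
    qed
  qed
  have "sx_le ?X (represent (d *\<^sub>R u)) a"
    unfolding represent_def a
    by (rule sx_le_classI[OF value_reps f value_dom_dense[of u]]) (use le in auto)
  moreover have "sx_le ?X (sx_zero ?X) (represent (d *\<^sub>R u))"
  proof -
    \<comment> \<open>Writing the element as its own positive part lets \<open>value_sup\<close>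
      deliver nonnegative values.\<close>
    have "represent (sup (d *\<^sub>R u) 0) = represent (d *\<^sub>R u)"
      using d u by (simp add: sup_absorb1 scaleR_nonneg_nonneg)
    moreover have "0 \<le> value_at (sup (d *\<^sub>R u) 0) p" if "p \<in> value_dom (d *\<^sub>R u)" "p \<in> value_dom 0" for p
      using value_sup(2)[OF that] value_scaleR(2)[OF that(2), of 0] by simp
    then have "sx_le ?X (sx_zero ?X) (represent (sup (d *\<^sub>R u) 0))"
      unfolding represent_def sx_zero_class
      by (intro sx_le_classI[OF sx_reps_zero value_reps
            dense_open_Int(2)[OF openin_value_dom value_dom_dense openin_value_dom value_dom_dense,
              of "d *\<^sub>R u" 0]]) auto
    ultimately show ?thesis by simp
  qed
  moreover have "sx_zero ?X \<noteq> represent (d *\<^sub>R u)"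
    using injD[OF inj_represent, of 0 "d *\<^sub>R u"] d(1) u(1) unfolding represent_zero[symmetric] by auto
  ultimately show "\<exists>b\<in>range represent. sx_lt ?X (sx_zero ?X) b \<and> sx_le ?X b a"
    unfolding sx_lt_def by blast
qed

end

section \<open>Order dense embeddings\<close>

text \<open>From here on the ultrafilters are forgotten: \<open>X\<close> is any topology and
  \<open>T\<close> any injective lattice homomorphism into S(X).\<close>

locale sx_embedding =
  fixes X :: "'x topology" and T :: "'a::{banach, ordered_real_vector, lattice} \<Rightarrow> 'x sx"
  assumes hom: "sx_lattice_hom X T" and inj: "inj T"
begin

lemma T_rep_exists: "\<exists>r. r \<in> sx_reps X \<and> T x = sx_class X (fst r) (snd r)"
proof -
  have "T x \<in> SX X" using hom by (simp add: sx_lattice_hom_def)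
  then obtain U f where "(U, f) \<in> sx_reps X" "T x = sx_class X U f" unfolding SX_iff by blast
  then show ?thesis by (intro exI[of _ "(U, f)"]) simp
qed

text \<open>One representative is fixed for each element. The domains chosen for \<open>x\<close>,
  \<open>y\<close> and \<open>x + y\<close> are unrelated, hence the membership assumptions in the
  pointwise rules below.\<close>

definition rep :: "'a \<Rightarrow> 'x set \<times> ('x \<Rightarrow> real)" where
  "rep x = (SOME r. r \<in> sx_reps X \<and> T x = sx_class X (fst r) (snd r))"

abbreviation dom :: "'a \<Rightarrow> 'x set" where "dom x \<equiv> fst (rep x)"

abbreviation val :: "'a \<Rightarrow> 'x \<Rightarrow> real" where "val x \<equiv> snd (rep x)"

lemma reps: "(dom x, val x) \<in> sx_reps X" and T_eq: "T x = sx_class X (dom x) (val x)"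
  using someI_ex[OF T_rep_exists, of x] unfolding rep_def[symmetric] by simp_all

lemma dense: "dense_open X (dom x)"
  using reps by (rule sx_reps_dense_open)

lemma T_in_SX: "T x \<in> SX X"
  using hom by (simp add: sx_lattice_hom_def)

lemma val_add:
  assumes "p \<in> dom (x + y)" "p \<in> dom x" "p \<in> dom y"
  shows "val (x + y) p = val x p + val y p"
proof -
  have "T (x + y) = sx_class X (dom x \<inter> dom y) (\<lambda>p. val x p + val y p)"
    using hom sx_add_class[OF reps[of x] reps[of y]] by (simp add: sx_lattice_hom_def T_eq[symmetric])
  then show ?thesis
    using sx_class_eqD[OF reps[of "x + y"]] assms by (simp add: T_eq)
qed

lemma val_scaleR:
  assumes "p \<in> dom (c *\<^sub>R x)" "p \<in> dom x"
  shows "val (c *\<^sub>R x) p = c * val x p"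
proof -
  have "T (c *\<^sub>R x) = sx_class X (dom x) (\<lambda>p. c * val x p)"
    using hom sx_scale_class[OF reps[of x]] by (simp add: sx_lattice_hom_def T_eq[symmetric])
  then show ?thesis
    using sx_class_eqD[OF reps[of "c *\<^sub>R x"]] assms by (simp add: T_eq)
qed

lemma val_sup:
  assumes "p \<in> dom (sup x y)" "p \<in> dom x" "p \<in> dom y"
  shows "val (sup x y) p = max (val x p) (val y p)"
proof -
  have "T (sup x y) = sx_class X (dom x \<inter> dom y) (\<lambda>p. max (val x p) (val y p))"
    using hom sx_sup_class[OF reps[of x] reps[of y]] by (simp add: sx_lattice_hom_def T_eq[symmetric])
  then show ?thesis
    using sx_class_eqD[OF reps[of "sup x y"]] assms by (simp add: T_eq)
qed

lemma val_inf:
  assumes "p \<in> dom (inf x y)" "p \<in> dom x" "p \<in> dom y"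
  shows "val (inf x y) p = min (val x p) (val y p)"
proof -
  have "T (inf x y) = sx_class X (dom x \<inter> dom y) (\<lambda>p. min (val x p) (val y p))"
    using hom sx_inf_class[OF reps[of x] reps[of y]] by (simp add: sx_lattice_hom_def T_eq[symmetric])
  then show ?thesis
    using sx_class_eqD[OF reps[of "inf x y"]] assms by (simp add: T_eq)
qed

lemma val_zero: "p \<in> dom 0 \<Longrightarrow> val 0 p = 0"
  using val_scaleR[of p 0 0] by simp

lemma val_minus:
  assumes "p \<in> dom (- x)" "p \<in> dom x"
  shows "val (- x) p = - val x p"
  using val_scaleR[of p "-1" x] assms by simp

lemma val_diff:
  assumes "p \<in> dom (x - y)" "p \<in> dom x" "p \<in> dom y"
  shows "val (x - y) p = val x p - val y p"
  using val_add[of p "x - y" y] assms by simp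

lemma T_zero: "T 0 = sx_zero X"
proof -
  have "sx_class X (dom 0) (val 0) = sx_class X (topspace X) (\<lambda>x. 0)"
    by (rule sx_class_eqI[OF reps sx_reps_zero closure_of_topspace]) (use val_zero in blast)
  then show ?thesis by (simp only: T_eq sx_zero_class)
qed

lemma T_le_iff_val: "sx_le X (T x) (T y) \<longleftrightarrow> (\<forall>p\<in>dom x \<inter> dom y. val x p \<le> val y p)"
proof -
  have "sx_le X (sx_class X (dom x) (val x)) (sx_class X (dom y) (val y)) \<longleftrightarrow>
      (\<forall>p\<in>dom x \<inter> dom y. val x p \<le> val y p)"
  proof
    assume "\<forall>p\<in>dom x \<inter> dom y. val x p \<le> val y p"
    then show "sx_le X (sx_class X (dom x) (val x)) (sx_class X (dom y) (val y))"
      by (intro sx_le_classI[OF reps reps closure_of_topspace]) simp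
  qed (intro ballI sx_le_classD[OF reps reps])
  then show ?thesis by (simp only: T_eq)
qed

text \<open>The order is equational, through \<open>sup x y = y\<close>, so injectivity makes
  \<open>T\<close> reflect it.\<close>

lemma T_le_iff: "sx_le X (T x) (T y) \<longleftrightarrow> x \<le> y"
proof
  assume "sx_le X (T x) (T y)"
  then have le: "val x p \<le> val y p" if "p \<in> dom x \<inter> dom y" for p
    using that by (simp add: T_le_iff_val)
  have "sx_class X (dom (sup x y)) (val (sup x y)) = sx_class X (dom y) (val y)"
    by (rule sx_class_eqI[OF reps reps dense_openD(2)[OF dense[of x]]])
      (simp add: val_sup le max_absorb2)
  then have "T (sup x y) = T y" by (simp only: T_eq)
  then have "sup x y = y" by (rule injD[OF inj])
  then show "x \<le> y" by (metis sup_ge1)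
next
  assume "x \<le> y"
  then have "sup x y = y" by (rule sup_absorb2)
  then have "val x p \<le> val y p" if "p \<in> dom x \<inter> dom y" for p
    using val_sup[of p x y] that by simp
  then show "sx_le X (T x) (T y)" by (simp add: T_le_iff_val)
qed

lemma val_mono: "x \<le> y \<Longrightarrow> p \<in> dom x \<Longrightarrow> p \<in> dom y \<Longrightarrow> val x p \<le> val y p"
  using T_le_iff[of x y] T_le_iff_val[of x y] by simp

lemma val_nonneg: "0 \<le> x \<Longrightarrow> p \<in> dom x \<Longrightarrow> p \<in> dom 0 \<Longrightarrow> 0 \<le> val x p"
  using val_mono[of 0 x p] val_zero by simp

text \<open>Inequalities in \<open>E\<close> are proved pointwise with this rule; \<open>D\<close>
  collects the domains of all representatives that the pointwise argument mentions.\<close>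

lemma leI:
  assumes D: "dense_open X D" and le: "\<And>p. p \<in> D \<Longrightarrow> p \<in> dom x \<Longrightarrow> p \<in> dom y \<Longrightarrow> val x p \<le> val y p"
  shows "x \<le> y"
proof -
  have "val x p \<le> val y p" if "p \<in> dom x \<inter> dom y" for p
    by (rule sx_reps_le_on_dense[OF reps reps dense_openD(2)[OF D] _ that]) (simp add: le)
  then have "sx_le X (T x) (T y)" by (simp add: T_le_iff_val)
  then show ?thesis by (simp only: T_le_iff)
qed

lemma positive_below:
  assumes od: "sx_order_dense X (range T)" and f: "(U, f) \<in> sx_reps X"
    and nonneg: "\<And>p. p \<in> U \<Longrightarrow> 0 \<le> f p" and "q \<in> U" "f q \<noteq> 0"
  shows "\<exists>z. 0 \<le> z \<and> z \<noteq> 0 \<and> (\<forall>p\<in>dom z \<inter> U. val z p \<le> f p)"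
proof -
  have "sx_le X (sx_zero X) (sx_class X U f)"
    unfolding sx_zero_class
    by (rule sx_le_classI[OF sx_reps_zero f closure_of_topspace]) (use nonneg in auto)
  moreover have "sx_zero X \<noteq> sx_class X U f"
    using sx_class_eqD[OF sx_reps_zero, of X U f q] \<open>q \<in> U\<close> \<open>f q \<noteq> 0\<close> openin_subset[OF sx_repsD(1)[OF f]]
    unfolding sx_zero_class by auto
  ultimately obtain z where z: "sx_lt X (sx_zero X) (T z)" "sx_le X (T z) (sx_class X U f)"
    using od f unfolding sx_order_dense_def sx_lt_def by (metis imageE sx_class_in_SX)
  have "0 \<le> z" "z \<noteq> 0"
    using z(1) T_le_iff[of 0 z] unfolding sx_lt_def T_zero[symmetric] by auto
  moreover have "\<forall>p\<in>dom z \<inter> U. val z p \<le> f p"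
    using sx_le_classD[OF reps[of z] f] z(2) unfolding T_eq[of z] by blast
  ultimately show ?thesis by blast
qed

lemma interval_in_range:
  assumes bl: "banach_lattice TYPE('a)" and oc: "order_continuous TYPE('a)"
    and od: "sx_order_dense X (range T)" and f: "(U, f) \<in> sx_reps X"
    and nonneg: "\<And>p. p \<in> U \<Longrightarrow> 0 \<le> f p" and bound: "\<And>p. p \<in> U \<inter> dom b \<Longrightarrow> f p \<le> val b p"
  shows "sx_class X U f \<in> range T"
proof -
  note U = sx_reps_dense_open[OF f]
  \<comment> \<open>If the supremum \<open>m\<close> of \<open>S\<close> differed from \<open>f\<close>, some \<open>z > 0\<close> would lie below the positive or the
    negative part of the difference, and then \<open>m - z\<close> would still bound \<open>S\<close>.\<close>
  define S where "S = {x. \<forall>p\<in>dom x \<inter> U. val x p \<le> f p}"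
  have SI: "x \<in> S" if D: "dense_open X D" and le: "\<And>p. p \<in> D \<Longrightarrow> p \<in> dom x \<Longrightarrow> p \<in> U \<Longrightarrow> val x p \<le> f p" for D x
  proof -
    have "val x p \<le> f p" if "p \<in> dom x \<inter> U" for p
      by (rule sx_reps_le_on_dense[OF reps f dense_openD(2)[OF D] _ that]) (simp add: le)
    then show ?thesis by (simp add: S_def)
  qed
  have SD: "val x p \<le> f p" if "x \<in> S" "p \<in> dom x" "p \<in> U" for x p
    using that by (simp add: S_def)
  have zero: "0 \<in> S" unfolding S_def using val_zero nonneg by auto
  have le_b: "x \<le> b" if "x \<in> S" for x
  proof (rule leI[OF U])
    fix p assume "p \<in> U" "p \<in> dom x" "p \<in> dom b"
    then show "val x p \<le> val b p" using SD[OF that, of p] bound[of p] by auto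
  qed
  have sup: "sup x y \<in> S" if "x \<in> S" "y \<in> S" for x y
  proof (rule SI[OF dense_open_IntI[OF dense[of x] dense[of y]]])
    fix p assume "p \<in> dom x \<inter> dom y" "p \<in> dom (sup x y)" "p \<in> U"
    then show "val (sup x y) p \<le> f p" using SD[OF that(1), of p] SD[OF that(2), of p] val_sup[of p x y] by auto
  qed
  obtain m where ub: "\<And>x. x \<in> S \<Longrightarrow> x \<le> m" and least: "\<And>y. (\<And>x. x \<in> S \<Longrightarrow> x \<le> y) \<Longrightarrow> m \<le> y"
    using order_continuous_directed_sup[OF bl oc zero le_b sup] by blast
  have no: False if z: "0 \<le> z" "z \<noteq> 0" and add: "\<And>x. x \<in> S \<Longrightarrow> x + z \<le> m" for z
  proof -
    have "m \<le> m - z" by (rule least) (use add in \<open>simp add: le_diff_eq\<close>)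
    then have "z \<le> 0" by simp
    then show False using z by simp
  qed
  have "val m q = f q" if q: "q \<in> dom m" "q \<in> U" for q
  proof (rule ccontr)
    assume "val m q \<noteq> f q"
    then consider "val m q < f q" | "f q < val m q" by linarith
    then show False
    proof cases
      case 1
      have g: "(U \<inter> dom m, \<lambda>p. max (f p - val m p) 0) \<in> sx_reps X"
        by (rule sx_reps_comp1[OF sx_reps_diff[OF f reps], where F = "\<lambda>t. max t 0"]) (intro continuous_intros)
      have "\<exists>z. 0 \<le> z \<and> z \<noteq> 0 \<and> (\<forall>p\<in>dom z \<inter> (U \<inter> dom m). val z p \<le> max (f p - val m p) 0)"
        by (rule positive_below[OF od g, of q]) (use 1 q in simp_all)
      then obtain z where z: "0 \<le> z" "z \<noteq> 0"
        and zle: "\<forall>p\<in>dom z \<inter> (U \<inter> dom m). val z p \<le> max (f p - val m p) 0"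
        by blast
      \<comment> \<open>Since \<open>x\<close> is below both \<open>f\<close> and \<open>m\<close>,
        adding \<open>z\<close> keeps it below \<open>f\<close>, whichever term attains the maximum.
        So \<open>x + z\<close> is itself a member of \<open>S\<close>.\<close>
      have "x + z \<le> m" if x: "x \<in> S" for x
      proof (rule ub, rule SI)
        show "dense_open X (dom x \<inter> dom z \<inter> dom m)" by (intro dense_open_IntI dense)
        fix p assume p: "p \<in> dom x \<inter> dom z \<inter> dom m" "p \<in> dom (x + z)" "p \<in> U"
        then have "val x p \<le> f p" "val x p \<le> val m p" "val z p \<le> max (f p - val m p) 0"
          using SD[OF x] val_mono[OF ub[OF x]] zle by auto
        then show "val (x + z) p \<le> f p" using val_add[of p x z] p by auto
      qed
      then show False by (rule no[OF z])
    next
      case 2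
      have g: "(dom m \<inter> U, \<lambda>p. max (val m p - f p) 0) \<in> sx_reps X"
        by (rule sx_reps_comp1[OF sx_reps_diff[OF reps f], where F = "\<lambda>t. max t 0"]) (intro continuous_intros)
      have "\<exists>z. 0 \<le> z \<and> z \<noteq> 0 \<and> (\<forall>p\<in>dom z \<inter> (dom m \<inter> U). val z p \<le> max (val m p - f p) 0)"
        by (rule positive_below[OF od g, of q]) (use 2 q in simp_all)
      then obtain z where z: "0 \<le> z" "z \<noteq> 0"
        and zle: "\<forall>p\<in>dom z \<inter> (dom m \<inter> U). val z p \<le> max (val m p - f p) 0"
        by blast
      \<comment> \<open>Now the comparison is with \<open>m\<close> directly: where \<open>z\<close>
        can be positive it is below \<open>m - f\<close>, while \<open>x\<close> is below
        \<open>f\<close>; elsewhere \<open>x \<le> m\<close> is enough.\<close>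
      have "x + z \<le> m" if x: "x \<in> S" for x
      proof (rule leI)
        show "dense_open X (dom x \<inter> dom z \<inter> U)" by (intro dense_open_IntI dense U)
        fix p assume p: "p \<in> dom x \<inter> dom z \<inter> U" "p \<in> dom (x + z)" "p \<in> dom m"
        then have "val x p \<le> f p" "val x p \<le> val m p" "val z p \<le> max (val m p - f p) 0"
          using SD[OF x] val_mono[OF ub[OF x]] zle by auto
        then show "val (x + z) p \<le> val m p" using val_add[of p x z] p by auto
      qed
      then show False by (rule no[OF z])
    qed
  qed
  then have "sx_class X (dom m) (val m) = sx_class X U f"
    by (intro sx_class_eqI[OF reps f closure_of_topspace]) simp
  then have "T m = sx_class X U f" by (simp only: T_eq)
  then show ?thesis by (metis rangeI)
qed

lemma val_labs:
  assumes "p \<in> dom (labs x)" "p \<in> dom x" "p \<in> dom (- x)"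
  shows "val (labs x) p = \<bar>val x p\<bar>"
  using val_sup[of p x "- x"] val_minus[of p x] assms unfolding labs_def by auto

text \<open>The content is solidity. The positive and the negative part of \<open>a\<close> lie
  between 0 and \<open>T (labs y)\<close>, so \<open>interval_in_range\<close> gives preimages of
  both, and the difference of these is a preimage of \<open>a\<close>.\<close>

lemma sx_ideal_range:
  assumes bl: "banach_lattice TYPE('a)" and oc: "order_continuous TYPE('a)"
    and od: "sx_order_dense X (range T)"
  shows "sx_ideal X (range T)"
  unfolding sx_ideal_def
proof (intro conjI ballI allI impI)
  show "range T \<subseteq> SX X" using T_in_SX by blast
  show "sx_zero X \<in> range T" by (metis T_zero rangeI)
  have add: "sx_add X (T x) (T y) = T (x + y)" and scale: "sx_scale X c (T x) = T (c *\<^sub>R x)" for x y c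
    using hom by (simp_all add: sx_lattice_hom_def)
  show "sx_add X a b \<in> range T" if "a \<in> range T" "b \<in> range T" for a b
    using that by (auto simp: add)
  show "sx_scale X c a \<in> range T" if "a \<in> range T" for a c
    using that by (auto simp: scale)
  fix a b assume "a \<in> SX X" "b \<in> range T" and le: "sx_le X (sx_abs X a) (sx_abs X b)"
  then obtain U f y where f: "(U, f) \<in> sx_reps X" and a: "a = sx_class X U f" and b: "b = T y"
    unfolding SX_iff by blast
  have "sx_le X (sx_class X U (\<lambda>p. \<bar>f p\<bar>)) (sx_class X (dom y) (\<lambda>p. \<bar>val y p\<bar>))"
    using le by (simp only: a b T_eq sx_abs_class[OF f] sx_abs_class[OF reps])
  then have "\<bar>f p\<bar> \<le> \<bar>val y p\<bar>" if "p \<in> U \<inter> dom y" for p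
    using that by (rule sx_le_classD[OF sx_reps_abs[OF f] sx_reps_abs[OF reps]])
  then have bound: "\<bar>f p\<bar> \<le> val (labs y) p" if "p \<in> U" "p \<in> dom (labs y)" "p \<in> dom y" "p \<in> dom (- y)" for p
    using val_labs that by simp
  have part: "\<exists>x. sx_class X U g = T x"
    if g: "(U, g) \<in> sx_reps X" and gf: "\<And>p. 0 \<le> g p \<and> g p \<le> \<bar>f p\<bar>" for g
  proof -
    have "g p \<le> val (labs y) p" if "p \<in> U \<inter> dom (labs y)" for p
    proof (rule sx_reps_le_on_dense[OF g reps _ _ that])
      show "X closure_of (dom y \<inter> dom (- y)) = topspace X"
        by (intro dense_openD dense_open_IntI dense)
      fix p assume p: "p \<in> U \<inter> dom (labs y) \<inter> (dom y \<inter> dom (- y))"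
      then have "\<bar>f p\<bar> \<le> val (labs y) p" by (intro bound) auto
      then show "g p \<le> val (labs y) p" using gf[of p] by linarith
    qed
    then have "sx_class X U g \<in> range T"
      using gf by (intro interval_in_range[OF bl oc od g]) auto
    then show ?thesis by blast
  qed
  have g1: "(U, \<lambda>p. max (f p) 0) \<in> sx_reps X" and g2: "(U, \<lambda>p. max (- f p) 0) \<in> sx_reps X"
    using sx_reps_comp1[OF f, of "\<lambda>t. max t 0"] sx_reps_comp1[OF f, of "\<lambda>t. max (- t) 0"]
    by (simp_all add: continuous_intros)
  have "\<exists>x. sx_class X U (\<lambda>p. max (f p) 0) = T x" "\<exists>x. sx_class X U (\<lambda>p. max (- f p) 0) = T x"
    by (rule part[OF g1] part[OF g2]; simp)+
  then obtain x1 x2 where x1: "sx_class X U (\<lambda>p. max (f p) 0) = T x1"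
    and x2: "sx_class X U (\<lambda>p. max (- f p) 0) = T x2" by blast
  have c1: "sx_class X U (\<lambda>p. max (f p) 0) = sx_class X (dom x1) (val x1)"
    and c2: "sx_class X U (\<lambda>p. max (- f p) 0) = sx_class X (dom x2) (val x2)"
    using x1 x2 by (simp_all only: T_eq)
  have v1: "max (f p) 0 = val x1 p" if "p \<in> U \<inter> dom x1" for p
    using that by (rule sx_class_eqD[OF g1 c1])
  have v2: "max (- f p) 0 = val x2 p" if "p \<in> U \<inter> dom x2" for p
    using that by (rule sx_class_eqD[OF g2 c2])
  have "val (x1 - x2) p = f p" if "p \<in> U" "p \<in> dom x1" "p \<in> dom x2" "p \<in> dom (x1 - x2)" for p
  proof -
    have "val (x1 - x2) p = max (f p) 0 - max (- f p) 0"
      using that val_diff[of p x1 x2] v1[of p] v2[of p] by simp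
    then show ?thesis by simp
  qed
  then have "sx_class X U f = sx_class X (dom (x1 - x2)) (val (x1 - x2))"
    by (intro sx_class_eqI[OF f reps dense_openD(2)[OF dense_open_IntI[OF dense[of x1] dense[of x2]]]]) simp
  then have "a = T (x1 - x2)" by (simp only: a T_eq)
  then show "a \<in> range T" by (rule range_eqI)
qed

end

section \<open>The unbounded norm topologies\<close>

text \<open>Serves both topologies. Balls shrink as \<open>w\<close> grows, so
  \<open>sup w w'\<close> with the smaller radius fits into an intersection.\<close>

lemma istopology_mono_balls:
  fixes d :: "'p \<Rightarrow> 'p \<Rightarrow> 'w::{ordered_ab_group_add,lattice} \<Rightarrow> real"
  assumes mono: "\<And>x z w w'. x \<in> S \<Longrightarrow> z \<in> S \<Longrightarrow> 0 \<le> w \<Longrightarrow> w \<le> w' \<Longrightarrow> d z x w \<le> d z x w'"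
  shows "istopology (\<lambda>U. U \<subseteq> S \<and> (\<forall>x\<in>U. \<exists>\<epsilon>>0. \<exists>w\<ge>0. {z\<in>S. d z x w < \<epsilon>} \<subseteq> U))"
  unfolding istopology_def
proof (intro conjI allI impI)
  fix U V
  assume U: "U \<subseteq> S \<and> (\<forall>x\<in>U. \<exists>\<epsilon>>0. \<exists>w\<ge>0. {z\<in>S. d z x w < \<epsilon>} \<subseteq> U)"
    and V: "V \<subseteq> S \<and> (\<forall>x\<in>V. \<exists>\<epsilon>>0. \<exists>w\<ge>0. {z\<in>S. d z x w < \<epsilon>} \<subseteq> V)"
  show "U \<inter> V \<subseteq> S" using U by blast
  show "\<forall>x\<in>U \<inter> V. \<exists>\<epsilon>>0. \<exists>w\<ge>0. {z\<in>S. d z x w < \<epsilon>} \<subseteq> U \<inter> V"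
  proof
    fix x assume x: "x \<in> U \<inter> V"
    then have "x \<in> S" using U by blast
    obtain e w where e: "0 < e" "0 \<le> w" "{z\<in>S. d z x w < e} \<subseteq> U" using U x by blast
    obtain e' w' where e': "0 < e'" "0 \<le> w'" "{z\<in>S. d z x w' < e'} \<subseteq> V" using V x by blast
    have "z \<in> U \<inter> V" if z: "z \<in> S" "d z x (sup w w') < min e e'" for z
    proof -
      have "d z x w \<le> d z x (sup w w')" "d z x w' \<le> d z x (sup w w')"
        using e e' z \<open>x \<in> S\<close> by (auto intro: mono)
      then have "d z x w < e" "d z x w' < e'" using z by auto
      then show ?thesis using e(3) e'(3) z(1) by blast
    qed
    then have "{z\<in>S. d z x (sup w w') < min e e'} \<subseteq> U \<inter> V" by blast
    moreover have "0 < min e e'" "0 \<le> sup w w'" using e e' by (auto intro: le_supI1)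
    ultimately show "\<exists>\<epsilon>>0. \<exists>w\<ge>0. {z\<in>S. d z x w < \<epsilon>} \<subseteq> U \<inter> V" by blast
  qed
next
  fix K assume K: "\<forall>U\<in>K. U \<subseteq> S \<and> (\<forall>x\<in>U. \<exists>\<epsilon>>0. \<exists>w\<ge>0. {z\<in>S. d z x w < \<epsilon>} \<subseteq> U)"
  show "\<Union>K \<subseteq> S" using K by blast
  show "\<forall>x\<in>\<Union>K. \<exists>\<epsilon>>0. \<exists>w\<ge>0. {z\<in>S. d z x w < \<epsilon>} \<subseteq> \<Union>K"
  proof
    fix x assume "x \<in> \<Union>K"
    then obtain U where U: "U \<in> K" "x \<in> U" by blast
    then obtain e w where "0 < e" "0 \<le> w" "{z\<in>S. d z x w < e} \<subseteq> U" using K by blast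
    then show "\<exists>\<epsilon>>0. \<exists>w\<ge>0. {z\<in>S. d z x w < \<epsilon>} \<subseteq> \<Union>K" using U by blast
  qed
qed

lemma openin_un_topology:
  fixes U :: "'a::{banach, ordered_real_vector, lattice} set"
  assumes bl: "banach_lattice TYPE('a)"
  shows "openin un_topology U \<longleftrightarrow>
    (\<forall>x\<in>U. \<exists>\<epsilon>>0. \<exists>w\<ge>0. {y. norm (inf (labs (y - x)) w) < \<epsilon>} \<subseteq> U)"
proof -
  have "norm (inf (labs (y - x)) w) \<le> norm (inf (labs (y - x)) w')" if "0 \<le> w" "w \<le> w'" for x y w w' :: 'a
    using that labs_nonneg[of "y - x"] by (intro banach_lattice_norm_mono[OF bl] inf_mono) auto
  then have "istopology (\<lambda>U::'a set. U \<subseteq> UNIV \<and>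
      (\<forall>x\<in>U. \<exists>\<epsilon>>0. \<exists>w\<ge>0. {y\<in>UNIV. norm (inf (labs (y - x)) w) < \<epsilon>} \<subseteq> U))"
    by (rule istopology_mono_balls)
  then show ?thesis by (simp add: un_topology_def topology_inverse')
qed

lemma topspace_un_topology:
  assumes "banach_lattice TYPE('a::{banach, ordered_real_vector, lattice})"
  shows "topspace (un_topology :: 'a topology) = UNIV"
proof -
  have "openin un_topology (UNIV :: 'a set)"
    unfolding openin_un_topology[OF assms] using zero_less_one by blast
  then show ?thesis using openin_subset by blast
qed

section \<open>Truncated distances and the extended topology\<close>

locale sx_ideal_embedding = sx_embedding X T
  for X :: "'x topology" and T :: "'a::{banach, ordered_real_vector, lattice} \<Rightarrow> 'x sx" +
  assumes bl: "banach_lattice TYPE('a)" and ideal: "sx_ideal X (range T)"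
begin

text \<open>The truncation of \<open>|z - y|\<close> by \<open>T w\<close>, pulled back to
  \<open>E\<close>. For \<open>z\<close> and \<open>y\<close> in S(X) and \<open>0 \<le> w\<close>
  it lies in the ideal \<open>range T\<close>, so \<open>inv_into\<close> is a genuine preimage;
  this is part of the proof of \<open>val_gap\<close>.\<close>

definition gap :: "'x sx \<Rightarrow> 'x sx \<Rightarrow> 'a \<Rightarrow> 'a" where
  "gap z y w = inv_into UNIV T (sx_inf X (sx_abs X (sx_diff X z y)) (T w))"

lemma val_gap:
  assumes f: "(U, f) \<in> sx_reps X" and g: "(V, g) \<in> sx_reps X" and w: "0 \<le> w"
    and p: "p \<in> U" "p \<in> V" "p \<in> dom w" "p \<in> dom (gap (sx_class X U f) (sx_class X V g) w)"
  shows "val (gap (sx_class X U f) (sx_class X V g) w) p = min \<bar>f p - g p\<bar> (val w p)"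
proof -
  define a where "a = sx_inf X (sx_abs X (sx_diff X (sx_class X U f) (sx_class X V g))) (T w)"
  note fg = sx_reps_diff[OF f g]
  note afg = sx_reps_abs[OF fg]
  note r = sx_reps_min[OF afg reps[of w]]
  have eq: "a = sx_class X (U \<inter> V \<inter> dom w) (\<lambda>p. min \<bar>f p - g p\<bar> (val w p))"
    unfolding a_def sx_diff_class[OF f g] sx_abs_class[OF fg] T_eq[of w] sx_inf_class[OF afg reps] ..
  \<comment> \<open>Solidity of the ideal is applied with the bound \<open>T w\<close>. The dense
    set \<open>dom 0\<close> appears because nonnegativity of \<open>val w\<close> is available
    there.\<close>
  have "sx_le X (sx_class X (U \<inter> V \<inter> dom w) (\<lambda>p. \<bar>min \<bar>f p - g p\<bar> (val w p)\<bar>))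
      (sx_class X (dom w) (\<lambda>p. \<bar>val w p\<bar>))"
  proof (rule sx_le_classI[OF sx_reps_abs[OF r] sx_reps_abs[OF reps] dense_openD(2)[OF dense[of 0]]])
    fix p assume "p \<in> U \<inter> V \<inter> dom w \<inter> dom w \<inter> dom 0"
    then have "0 \<le> val w p" using val_nonneg[OF w, of p] by simp
    then show "\<bar>min \<bar>f p - g p\<bar> (val w p)\<bar> \<le> \<bar>val w p\<bar>" by simp
  qed
  then have "sx_le X (sx_abs X a) (sx_abs X (T w))"
    by (simp only: eq sx_abs_class[OF r] T_eq[of w] sx_abs_class[OF reps])
  moreover have "a \<in> SX X" unfolding eq by (rule sx_class_in_SX[OF r])
  ultimately have "a \<in> range T" using ideal unfolding sx_ideal_def by blast
  then have "T (gap (sx_class X U f) (sx_class X V g) w) = a"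
    unfolding gap_def a_def by (rule f_inv_into_f)
  then have "sx_class X (dom (gap (sx_class X U f) (sx_class X V g) w)) (val (gap (sx_class X U f) (sx_class X V g) w)) =
      sx_class X (U \<inter> V \<inter> dom w) (\<lambda>p. min \<bar>f p - g p\<bar> (val w p))"
    by (simp only: T_eq eq)
  then show ?thesis by (rule sx_class_eqD[OF reps]) (simp add: p)
qed

lemma gap_nonneg:
  assumes "z \<in> SX X" "y \<in> SX X" "0 \<le> w"
  shows "0 \<le> gap z y w"
proof -
  obtain U f V g where f: "(U, f) \<in> sx_reps X" "z = sx_class X U f"
    and g: "(V, g) \<in> sx_reps X" "y = sx_class X V g"
    using assms unfolding SX_iff by blast
  show ?thesis
  proof (rule leI)
    show "dense_open X (U \<inter> V \<inter> dom w)" by (intro dense_open_IntI sx_reps_dense_open[OF f(1)] sx_reps_dense_open[OF g(1)] dense)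
    fix p assume "p \<in> U \<inter> V \<inter> dom w" "p \<in> dom 0" "p \<in> dom (gap z y w)"
    then show "val 0 p \<le> val (gap z y w) p"
      using val_gap[OF f(1) g(1) assms(3), of p] val_nonneg[OF assms(3), of p] val_zero[of p]
      unfolding f(2) g(2) by auto
  qed
qed

lemma gap_mono:
  assumes "z \<in> SX X" "y \<in> SX X" "0 \<le> w" "w \<le> w'"
  shows "gap z y w \<le> gap z y w'"
proof -
  obtain U f V g where f: "(U, f) \<in> sx_reps X" "z = sx_class X U f"
    and g: "(V, g) \<in> sx_reps X" "y = sx_class X V g"
    using assms unfolding SX_iff by blast
  have w': "0 \<le> w'" using assms by simp
  show ?thesis
  proof (rule leI)
    show "dense_open X (U \<inter> V \<inter> dom w \<inter> dom w')"
      by (intro dense_open_IntI sx_reps_dense_open[OF f(1)] sx_reps_dense_open[OF g(1)] dense)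
    fix p assume "p \<in> U \<inter> V \<inter> dom w \<inter> dom w'" "p \<in> dom (gap z y w)" "p \<in> dom (gap z y w')"
    then show "val (gap z y w) p \<le> val (gap z y w') p"
      using val_gap[OF f(1) g(1) assms(3), of p] val_gap[OF f(1) g(1) w', of p] val_mono[OF assms(4), of p]
      unfolding f(2) g(2) by auto
  qed
qed

text \<open>Truncation by a fixed nonnegative number is subadditive on nonnegative reals. Since
  \<open>w\<close> is the same on both sides, each \<open>w\<close> has its own triangle inequality,
  which is what makes the balls of S(X) open.\<close>

lemma gap_triangle:
  assumes "z \<in> SX X" "y \<in> SX X" "x \<in> SX X" "0 \<le> w"
  shows "gap z x w \<le> gap z y w + gap y x w"
proof -
  obtain U f V g W h where f: "(U, f) \<in> sx_reps X" "z = sx_class X U f"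
    and g: "(V, g) \<in> sx_reps X" "y = sx_class X V g" and h: "(W, h) \<in> sx_reps X" "x = sx_class X W h"
    using assms unfolding SX_iff by blast
  show ?thesis
  proof (rule leI)
    show "dense_open X (U \<inter> V \<inter> W \<inter> dom w \<inter> dom 0 \<inter> dom (gap z y w) \<inter> dom (gap y x w))"
      by (intro dense_open_IntI sx_reps_dense_open[OF f(1)] sx_reps_dense_open[OF g(1)]
          sx_reps_dense_open[OF h(1)] dense)
    fix p assume p: "p \<in> U \<inter> V \<inter> W \<inter> dom w \<inter> dom 0 \<inter> dom (gap z y w) \<inter> dom (gap y x w)"
      "p \<in> dom (gap z x w)" "p \<in> dom (gap z y w + gap y x w)"
    then have "val (gap z x w) p = min \<bar>f p - h p\<bar> (val w p)" "val (gap z y w) p = min \<bar>f p - g p\<bar> (val w p)"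
      "val (gap y x w) p = min \<bar>g p - h p\<bar> (val w p)" "0 \<le> val w p"
      using val_gap[OF f(1) h(1) assms(4), of p] val_gap[OF f(1) g(1) assms(4), of p]
        val_gap[OF g(1) h(1) assms(4), of p] val_nonneg[OF assms(4), of p]
      unfolding f(2) g(2) h(2) by auto
    then show "val (gap z x w) p \<le> val (gap z y w + gap y x w) p"
      using val_add[of p "gap z y w" "gap y x w"] p by (simp add: min_def) linarith
  qed
qed

lemma gap_T:
  assumes w: "0 \<le> w"
  shows "gap (T x) (T y) w = inf (labs (x - y)) w"
proof -
  let ?z = "inf (labs (x - y)) w"
  define D where "D = dom x \<inter> dom y \<inter> dom w \<inter> dom (x - y) \<inter> dom (- (x - y)) \<inter> dom (labs (x - y))"
  have D: "dense_open X D" unfolding D_def by (intro dense_open_IntI dense)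
  have eq: "val (gap (T x) (T y) w) p = val ?z p" if "p \<in> D" "p \<in> dom (gap (T x) (T y) w)" "p \<in> dom ?z" for p
    using that val_gap[OF reps[of x] reps[of y] w, of p] val_inf[of p "labs (x - y)" w] val_labs[of p "x - y"]
      val_diff[of p x y]
    unfolding D_def T_eq[of x, symmetric] T_eq[of y, symmetric] by auto
  show ?thesis by (rule order_antisym; rule leI[OF D]) (simp_all add: eq)
qed

lemma norm_gap_triangle:
  assumes "z \<in> SX X" "y \<in> SX X" "x \<in> SX X" "0 \<le> w"
  shows "norm (gap z x w) \<le> norm (gap z y w) + norm (gap y x w)"
proof -
  have "norm (gap z x w) \<le> norm (gap z y w + gap y x w)"
    by (rule banach_lattice_norm_mono[OF bl gap_nonneg[OF assms(1,3,4)] gap_triangle[OF assms]])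
  also have "\<dots> \<le> norm (gap z y w) + norm (gap y x w)" by (rule norm_triangle_ineq)
  finally show ?thesis .
qed

abbreviation ext_topology :: "'x sx topology" where
  "ext_topology \<equiv> ext_un_topology X (range T) (\<lambda>v. norm (inv_into UNIV T v))"

lemma openin_ext_topology:
  "openin ext_topology U \<longleftrightarrow> U \<subseteq> SX X \<and>
     (\<forall>y\<in>U. \<exists>\<epsilon>>0. \<exists>w\<ge>0. {z\<in>SX X. norm (gap z y w) < \<epsilon>} \<subseteq> U)"
proof -
  have "norm (gap z x w) \<le> norm (gap z x w')" if "x \<in> SX X" "z \<in> SX X" "0 \<le> w" "w \<le> w'" for x z w w'
    by (rule banach_lattice_norm_mono[OF bl gap_nonneg[OF that(2,1,3)] gap_mono[OF that(2,1,3,4)]])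
  then have top: "istopology (\<lambda>U. U \<subseteq> SX X \<and>
     (\<forall>y\<in>U. \<exists>\<epsilon>>0. \<exists>w\<ge>0. {z\<in>SX X. norm (gap z y w) < \<epsilon>} \<subseteq> U))"
    by (rule istopology_mono_balls)
  have nonneg: "sx_le X (sx_zero X) (T w) \<longleftrightarrow> 0 \<le> w" for w
    by (simp only: T_zero[symmetric] T_le_iff)
  have "ext_topology = topology (\<lambda>U. U \<subseteq> SX X \<and>
     (\<forall>y\<in>U. \<exists>\<epsilon>>0. \<exists>w\<ge>0. {z\<in>SX X. norm (gap z y w) < \<epsilon>} \<subseteq> U))"
    by (simp only: ext_un_topology_def gap_def bex_simps(7) bex_UNIV nonneg)
  then show ?thesis using topology_inverse'[OF top] by simp
qed

lemma topspace_ext_topology: "topspace ext_topology = SX X"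
proof -
  have "openin ext_topology (SX X)"
    unfolding openin_ext_topology using zero_less_one by blast
  then have "SX X \<subseteq> topspace ext_topology" by (rule openin_subset)
  moreover have "topspace ext_topology \<subseteq> SX X"
    using openin_topspace[of ext_topology] unfolding openin_ext_topology by (rule conjunct1)
  ultimately show ?thesis by (rule subset_antisym[rotated])
qed

text \<open>Continuity restricts balls from S(X) to the image by \<open>gap_T\<close>. Openness goes
  the other way and relies on the triangle inequality with centres outside
  \<open>range T\<close>.\<close>

lemma homeomorphic_map_un_ext:
  "homeomorphic_map un_topology (subtopology ext_topology (range T)) T"
proof (rule bijective_open_imp_homeomorphic_map)
  have top: "topspace (subtopology ext_topology (range T)) = range T"
    using T_in_SX by (auto simp: topspace_ext_topology)
  show "T ` topspace un_topology = topspace (subtopology ext_topology (range T))"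
    by (simp only: top topspace_un_topology[OF bl])
  show "inj_on T (topspace un_topology)" using inj by (simp add: topspace_un_topology[OF bl])
  show "continuous_map un_topology (subtopology ext_topology (range T)) T"
    unfolding continuous_map top
  proof (intro conjI allI impI)
    show "T ` topspace un_topology \<subseteq> range T" by blast
    fix S assume "openin (subtopology ext_topology (range T)) S"
    then obtain W where W: "openin ext_topology W" "S = W \<inter> range T" by (auto simp: openin_subtopology)
    show "openin un_topology {x \<in> topspace un_topology. T x \<in> S}"
      unfolding openin_un_topology[OF bl]
    proof
      fix x assume "x \<in> {x \<in> topspace un_topology. T x \<in> S}"
      then have "T x \<in> W" using W by simp
      then obtain e w where e: "0 < e" "0 \<le> w" "{z\<in>SX X. norm (gap z (T x) w) < e} \<subseteq> W"
        using W(1) unfolding openin_ext_topology by blast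
      have "{y. norm (inf (labs (y - x)) w) < e} \<subseteq> {x \<in> topspace un_topology. T x \<in> S}"
      proof clarify
        fix y assume "norm (inf (labs (y - x)) w) < e"
        then have "norm (gap (T y) (T x) w) < e" by (simp only: gap_T[OF e(2)])
        then show "y \<in> topspace un_topology \<and> T y \<in> S"
          using e(3) T_in_SX[of y] W(2) by (auto simp: topspace_un_topology[OF bl])
      qed
      then show "\<exists>\<epsilon>>0. \<exists>w\<ge>0. {y. norm (inf (labs (y - x)) w) < \<epsilon>} \<subseteq> {x \<in> topspace un_topology. T x \<in> S}"
        using e(1,2) by blast
    qed
  qed
  show "open_map un_topology (subtopology ext_topology (range T)) T"
    unfolding open_map_def
  proof (intro allI impI)
    fix U :: "'a set" assume U: "openin un_topology U"
    \<comment> \<open>The union of the balls of S(X) centred at some \<open>T x\<close> with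
      \<open>x \<in> U\<close> whose counterpart in \<open>E\<close> stays inside \<open>U\<close>.
      This condition keeps \<open>W\<close> from meeting \<open>range T\<close> outside the image of
      \<open>U\<close>.\<close>
    define W where "W = {z\<in>SX X. \<exists>x\<in>U. \<exists>e>0. \<exists>w\<ge>0.
      {y. norm (inf (labs (y - x)) w) < e} \<subseteq> U \<and> norm (gap z (T x) w) < e}"
    have "openin ext_topology W"
      unfolding openin_ext_topology
    proof (intro conjI ballI)
      show "W \<subseteq> SX X" by (auto simp: W_def)
      fix z assume "z \<in> W"
      then obtain x e w where x: "z \<in> SX X" "x \<in> U" "0 < e" "0 \<le> w"
        "{y. norm (inf (labs (y - x)) w) < e} \<subseteq> U" "norm (gap z (T x) w) < e"
        unfolding W_def by blast
      have "z' \<in> W" if z': "z' \<in> SX X" "norm (gap z' z w) < e - norm (gap z (T x) w)" for z'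
      proof -
        have "norm (gap z' (T x) w) < e"
          using norm_gap_triangle[OF z'(1) x(1) T_in_SX[of x] x(4)] z'(2) by linarith
        then show ?thesis unfolding W_def using x z'(1) by blast
      qed
      then have "{z'\<in>SX X. norm (gap z' z w) < e - norm (gap z (T x) w)} \<subseteq> W" by blast
      moreover have "0 < e - norm (gap z (T x) w)" using x(6) by simp
      ultimately show "\<exists>\<epsilon>>0. \<exists>w\<ge>0. {z'\<in>SX X. norm (gap z' z w) < \<epsilon>} \<subseteq> W" using x(4) by blast
    qed
    moreover have "T ` U = W \<inter> range T"
    proof (intro subset_antisym subsetI IntI)
      fix a assume "a \<in> T ` U"
      then obtain u where u: "u \<in> U" "a = T u" by blast
      then show "a \<in> range T" by blast
      obtain e w where e: "0 < e" "0 \<le> w" "{y. norm (inf (labs (y - u)) w) < e} \<subseteq> U"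
        using U u(1) unfolding openin_un_topology[OF bl] by blast
      have "norm (gap (T u) (T u) w) < e"
        using e(1,2) by (simp add: gap_T labs_def inf_absorb1)
      then show "a \<in> W" unfolding W_def using u e T_in_SX[of u] by blast
    next
      fix a assume a: "a \<in> W \<inter> range T"
      then obtain u where u: "a = T u" "T u \<in> W" by blast
      then obtain x e w where x: "0 \<le> w" "{y. norm (inf (labs (y - x)) w) < e} \<subseteq> U"
        "norm (gap (T u) (T x) w) < e"
        unfolding W_def by blast
      then have "u \<in> U" by (auto simp: gap_T)
      then show "a \<in> T ` U" using u by blast
    qed
    ultimately show "openin (subtopology ext_topology (range T)) (T ` U)"
      unfolding openin_subtopology by blast
  qed
qed

end

theorem theorem3p8:
  assumes "banach_lattice TYPE('a::{banach, ordered_real_vector, lattice})"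
    and "order_continuous TYPE('a)"
  shows "\<exists>(X :: 'a set set topology) (T :: 'a \<Rightarrow> 'a set set sx).
           Hausdorff_space X \<and> sx_lattice_hom X T \<and> inj T \<and>
           sx_ideal X (range T) \<and> sx_order_dense X (range T) \<and>
           homeomorphic_map un_topology
             (subtopology (ext_un_topology X (range T) (\<lambda>v. norm (inv_into UNIV T v))) (range T)) T"
proof -
  obtain A :: "'a set" where "unit_family A"
    using unit_family_exists[OF banach_lattice_archimedean[OF assms(1)]] by blast
  then interpret unit_family A .
  have hom: "sx_lattice_hom ultra_topology represent"
    unfolding sx_lattice_hom_def
    by (simp add: represent_in_SX represent_add represent_scaleR represent_sup represent_inf)
  interpret sx_embedding ultra_topology represent
    using hom inj_represent by unfold_locales
  have ideal: "sx_ideal ultra_topology (range represent)"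
    by (rule sx_ideal_range[OF assms represent_order_dense])
  interpret sx_ideal_embedding ultra_topology represent
    using assms(1) ideal by unfold_locales
  show ?thesis
    using Hausdorff_ultra_topology hom inj_represent ideal represent_order_dense homeomorphic_map_un_ext
    by blast
qed

end
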